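(* There exists an absolute constant $c>0$ such that the following holds. Let $n\ge 1$ be an integer and let $F\in\mathfrak F$ be a distribution represented in the form $$F=(1-p)\,U+p\,V,\qquad U,V\in\mathfrak F,\quad 0<p<1.$$ Let $X$ be a random variable with $\mathcal L(X)=U$. Suppose that $$0<\sigma^2=\mathbf E X^2<\infty,\qquad \mathbf E X=0\qquad(\sigma>0),$$ and $$b\ge\frac{\varkappa_n}{\sigma^2},\qquad\text{where}\quad \varkappa_n=\mathbf E\, X^2\min\{|X|,\,\sigma\sqrt n\}.$$ Then, for any distribution $H\in\mathfrak F$, $$Q(HF^n,b)\le\frac{c\,b}{\sigma\sqrt{n(1-p)}}\,Q\big(H,\,\sigma\sqrt n\big).$$
   Context: $\mathfrak F$ denotes the set of probability distributions on the Borel $\sigma$-field of $\mathbf R$; $\mathcal L(\xi)\in\mathfrak F$ is the distribution of a random variable $\xi$. For $F\in\mathfrak F$ and $b\ge0$ the concentration function is $Q(F,b)=\sup_{x\in\mathbf R}F\{[x,x+b]\}$. Products and powers of measures are in the convolution sense: $FH=F*H$, $H^m=H^{m*}$ ($m$-fold convolution). An absolute constant is a positive number depending on none of the objects in the statement ($n,p,F,U,V,H,b$). *)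

theory Defs
  imports "HOL-Probability.Probability"
begin

text \<open>
  Probability distributions on the Borel sigma-field of the reals are the measures satisfying
  the library predicate \<open>real_distribution\<close>; their product is the library's convolution.
  Expectations of functions of a random variable with distribution \<open>U\<close> are taken on the
  probability space \<open>U\<close> itself, the random variable being the identity.
\<close>

text \<open>
  The supremum is the conditionally complete one on the reals; it is meaningful because
  the values lie between 0 and 1 (\<open>bdd_above_conc_fun\<close>).
\<close>

definition conc_fun :: "real measure \<Rightarrow> real \<Rightarrow> real" where
  "conc_fun F b = (SUP x. measure F {x..x + b})"

primrec conv_power :: "real measure \<Rightarrow> nat \<Rightarrow> real measure" where
  "conv_power F 0 = return borel 0"
| "conv_power F (Suc n) = convolution F (conv_power F n)"

text \<open>For a centred \<open>U\<close> with standard deviation \<open>\<sigma>\<close>, the third moment with one factor truncated at \<open>\<sigma> \<surd>n\<close>.\<close>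

definition trunc_moment :: "real measure \<Rightarrow> real \<Rightarrow> nat \<Rightarrow> real" where
  "trunc_moment U \<sigma> n = (LINT x|U. x\<^sup>2 * min \<bar>x\<bar> (\<sigma> * sqrt (real n)))"

lemma bdd_above_conc_fun:
  assumes "real_distribution F"
  shows "bdd_above (range (\<lambda>x. measure F {x..x + b}))"
proof -
  interpret real_distribution F by fact
  show ?thesis by (rule bdd_aboveI2[where M = 1]) simp
qed

lemma real_distribution_convolution:
  assumes "real_distribution F" "real_distribution G"
  shows "real_distribution (convolution F G)"
proof -
  interpret F: real_distribution F by fact
  interpret G: real_distribution G by fact
  interpret P: pair_prob_space F G ..
  show ?thesis
    unfolding convolution_def by (intro P.real_distribution_distr) measurable
qed

lemma real_distribution_conv_power:
  assumes "real_distribution F"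
  shows "real_distribution (conv_power F n)"
proof (induction n)
  case 0
  show ?case
    by (simp add: real_distribution_def real_distribution_axioms_def prob_space_return)
next
  case (Suc n)
  then show ?case
    using assms by (simp add: real_distribution_convolution)
qed

end

theory Submission
  imports Defs
begin

text \<open>
  Write \<open>T = \<sigma> \<surd>n\<close>, \<open>Q\<close> for the concentration function, \<open>S\<close> for a sum of independent variables with
  distribution \<open>U\<close> and \<open>\<chi>\<close> for the characteristic function of \<open>U\<close>.

  Expanding the \<open>n\<close>-fold convolution of \<open>F = (1 - p) U + p V\<close> gives a binomial mixture of the
  distributions \<open>V^(n-k) U^k\<close>. A factor \<open>V\<close> may be absorbed into \<open>H\<close>, because convolution never increases
  \<open>Q\<close>. So it suffices to bound \<open>Q(G U^k, b)\<close> by a constant times \<open>b / (\<sigma> \<surd>(k + 1)) Q(G, T)\<close> for every \<open>G\<close> and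
  every \<open>k \<le> n\<close> (\<open>conc_fun_le_any_power\<close>) and to average over \<open>k\<close>: if \<open>N\<close> is binomial with parameters
  \<open>n\<close> and \<open>1 - p\<close>, then \<open>1 / (N + 1)\<close> has mean at most \<open>1 / ((n + 1) (1 - p))\<close>
  (\<open>conc_fun_mixture_power_le\<close>, \<open>mix_weight_le\<close>).

  For the power of \<open>U\<close>, an estimate of \<open>Q(G U^n, b)\<close> through the absolute value of its characteristic
  function is too weak: the modulus of the transform of \<open>G\<close> is controlled by the square root of \<open>Q(G, T)\<close>
  only. Instead, \<open>U^n\<close> alone is estimated by the local bound with polynomial decay
  \<open>P(u \<le> S \<le> u + b) \<le> C (b / T) / (1 + (u / T)\<^sup>2)\<close> (\<open>measure_conv_power_interval_le\<close>), valid if \<open>b \<le> T\<close>. Integrating it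
  against \<open>G\<close> over cells of length \<open>T\<close>, each of mass at most \<open>Q(G, T)\<close>, produces a convergent series
  (\<open>nn_integral_cauchy_weight_le\<close>).

  The local bound comes from a smoothing inequality (\<open>smoothing_inequality\<close>) that keeps the weight
  \<open>w(s) = 1 + (s / T)\<^sup>2\<close>: a Fejer kernel of bandwidth \<open>a = 1 / (4 b)\<close> dominates the indicator of the interval, so
  the weighted mass is at most a multiple of \<open>b\<close> times the integral over \<open>0 \<le> t \<le> a\<close> of the modulus of
  \<open>E w(S) e^(itS)\<close>. In that expectation powers of \<open>\<chi>\<close> multiply its
  first two derivatives (\<open>char_moment_conv_power\<close>). The hypothesis
  \<open>trunc_moment U \<sigma> n \<le> b \<sigma>\<^sup>2\<close> ensures that the third-order error in the expansion of \<open>\<chi>\<close> stays below the main term up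
  to \<open>|t| = a\<close>: there \<open>|\<chi>(t)| \<le> exp(- \<sigma>\<^sup>2 t\<^sup>2 / 4)\<close> once \<open>|t| \<ge> 1 / T\<close> (\<open>norm_char_le_exp\<close>), while for smaller \<open>t\<close>
  the function \<open>exp(- T\<^sup>2 t\<^sup>2 / 4)\<close> is bounded below by a constant. The integral is therefore of order \<open>1 / T\<close>.
\<close>

section \<open>Convolution and concentration functions\<close>

lemma measure_le_conc_fun:
  assumes "real_distribution H"
  shows "measure H {x..x + b} \<le> conc_fun H b"
  unfolding conc_fun_def by (rule cSUP_upper[OF _ bdd_above_conc_fun[OF assms]]) simp

lemma conc_fun_leI:
  assumes "\<And>x. measure H {x..x + b} \<le> c"
  shows "conc_fun H b \<le> c"
  unfolding conc_fun_def by (rule cSUP_least) (use assms in auto)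

lemma conc_fun_nonneg: "real_distribution H \<Longrightarrow> 0 \<le> conc_fun H b"
  using measure_le_conc_fun[of H 0 b] measure_nonneg[of H "{0..0 + b}"] by linarith

lemma conc_fun_mono:
  assumes "real_distribution H" "b \<le> c"
  shows "conc_fun H b \<le> conc_fun H c"
proof (rule conc_fun_leI)
  interpret real_distribution H by fact
  fix x
  have "measure H {x..x + b} \<le> measure H {x..x + c}"
    using assms by (intro finite_measure_mono) auto
  also have "\<dots> \<le> conc_fun H c" by (rule measure_le_conc_fun) fact
  finally show "measure H {x..x + b} \<le> conc_fun H c" .
qed

lemma conc_fun_scale:
  assumes H: "real_distribution H" and T: "T > 0" and b: "b \<ge> 0"
  shows "conc_fun H b \<le> (b / T + 1) * conc_fun H T"
proof (rule conc_fun_leI)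
  interpret real_distribution H by fact
  fix x
  define m where "m = nat \<lfloor>b / T\<rfloor>"
  have m: "real m \<le> b / T" "b / T < real m + 1"
    using T b by (auto simp: m_def)
  have "{x..x + b} \<subseteq> (\<Union>i\<in>{..m}. {(x + i * T)..(x + i * T) + T})"
  proof
    fix y assume y: "y \<in> {x..x + b}"
    define i where "i = nat \<lfloor>(y - x) / T\<rfloor>"
    have i: "real i \<le> (y - x) / T" "(y - x) / T < real i + 1"
      using T y by (auto simp: i_def)
    have "(y - x) / T \<le> b / T" using T y by (intro divide_right_mono) auto
    then have "i \<le> m" using i m by linarith
    moreover have "i * T \<le> y - x" "y - x < (i + 1) * T"
      using i T by (auto simp: field_simps)
    ultimately show "y \<in> (\<Union>i\<in>{..m}. {(x + i * T)..(x + i * T) + T})"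
      by (intro UN_I[of i]) (auto simp: algebra_simps)
  qed
  then have "measure H {x..x + b} \<le> measure H (\<Union>i\<in>{..m}. {(x + i * T)..(x + i * T) + T})"
    by (intro finite_measure_mono) auto
  also have "\<dots> \<le> (\<Sum>i\<in>{..m}. measure H {(x + i * T)..(x + i * T) + T})"
    by (intro finite_measure_subadditive_finite) auto
  also have "\<dots> \<le> (\<Sum>i\<in>{..m}. conc_fun H T)"
    by (intro sum_mono measure_le_conc_fun H)
  also have "\<dots> \<le> (b / T + 1) * conc_fun H T"
    using m conc_fun_nonneg[OF H] by (auto intro!: mult_right_mono)
  finally show "measure H {x..x + b} \<le> (b / T + 1) * conc_fun H T" .
qed

lemma emeasure_convolution_interval:
  assumes "real_distribution G" "real_distribution N"
  shows "emeasure (convolution G N) {x..x + b} = (\<integral>\<^sup>+ y. emeasure N {x - y..x - y + b} \<partial>G)"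
proof -
  interpret G: real_distribution G by fact
  interpret N: real_distribution N by fact
  have "emeasure (convolution G N) {x..x + b} = (\<integral>\<^sup>+ y. emeasure N {s. s + y \<in> {x..x + b}} \<partial>G)"
    by (rule convolution_emeasure) (auto intro: G.finite_measure_axioms N.finite_measure_axioms)
  also have "\<dots> = (\<integral>\<^sup>+ y. emeasure N {x - y..x - y + b} \<partial>G)"
    by (intro nn_integral_cong arg_cong[where f = "emeasure N"]) auto
  finally show ?thesis .
qed

lemma convolution_commute:
  assumes "real_distribution G" "real_distribution N"
  shows "convolution G N = convolution N G"
proof -
  interpret G: real_distribution G by fact
  interpret N: real_distribution N by fact
  show ?thesis
    by (rule convolution_commutative) (auto intro: G.finite_measure_axioms N.finite_measure_axioms)
qed

lemma convolution_assoc: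
  assumes "real_distribution L" "real_distribution G" "real_distribution N"
  shows "convolution (convolution L G) N = convolution L (convolution G N)"
proof -
  interpret L: real_distribution L by fact
  interpret G: real_distribution G by fact
  interpret N: real_distribution N by fact
  show ?thesis
    by (rule convolution_associative[symmetric])
       (auto intro: G.finite_measure_axioms N.finite_measure_axioms L.finite_measure_axioms)
qed

lemma convolution_return_0:
  assumes "real_distribution H"
  shows "convolution H (return borel 0) = H"
proof (rule measure_eqI)
  interpret H: real_distribution H by fact
  interpret R: prob_space "return borel (0::real)" by (rule prob_space_return) simp
  show "sets (convolution H (return borel 0)) = sets H" by simp
  fix A assume "A \<in> sets (convolution H (return borel 0))"
  then have [measurable]: "A \<in> sets borel" by simp
  have shift: "{s. s + x \<in> A} \<in> sets borel" for x :: real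
  proof -
    have "(\<lambda>s. s + x) -` A \<inter> space borel \<in> sets borel" by measurable
    then show ?thesis by (simp add: vimage_def)
  qed
  have "emeasure (convolution H (return borel 0)) A
      = (\<integral>\<^sup>+ x. emeasure (return borel 0) {s. s + x \<in> A} \<partial>H)"
    by (rule convolution_emeasure)
      (auto intro: H.finite_measure_axioms R.finite_measure_axioms)
  also have "\<dots> = (\<integral>\<^sup>+ x. indicator A x \<partial>H)"
    by (intro nn_integral_cong) (simp add: shift indicator_def)
  also have "\<dots> = emeasure H A" by simp
  finally show "emeasure (convolution H (return borel 0)) A = emeasure H A" .
qed

lemma conc_fun_convolution_le:
  assumes "real_distribution G" "real_distribution N"
  shows "conc_fun (convolution G N) b \<le> conc_fun G b"
proof (rule conc_fun_leI)
  interpret G: real_distribution G by fact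
  interpret N: real_distribution N by fact
  interpret C: real_distribution "convolution G N" by (intro real_distribution_convolution assms)
  fix x
  have "emeasure (convolution G N) {x..x + b} = (\<integral>\<^sup>+ y. emeasure G {x - y..x - y + b} \<partial>N)"
    by (simp add: convolution_commute[OF assms] emeasure_convolution_interval assms)
  also have "\<dots> \<le> (\<integral>\<^sup>+ y. ennreal (conc_fun G b) \<partial>N)"
    by (intro nn_integral_mono) (simp add: G.emeasure_eq_measure measure_le_conc_fun assms conc_fun_nonneg)
  also have "\<dots> = ennreal (conc_fun G b)"
    using N.emeasure_space_1 by (simp add: N.space_eq_univ)
  finally show "measure (convolution G N) {x..x + b} \<le> conc_fun G b"
    by (simp add: C.emeasure_eq_measure conc_fun_nonneg assms)
qed

definition cauchy_cell_sum :: real where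
  "cauchy_cell_sum = 2 * (\<Sum>j. 1 / (1 + (real j)\<^sup>2))"

lemma summable_cauchy_cells: "summable (\<lambda>j. 1 / (1 + (real j)\<^sup>2))"
proof (rule summable_comparison_test_ev)
  show "summable (\<lambda>n. inverse (real n ^ 2))" by (rule inverse_power_summable) simp
  show "\<forall>\<^sub>F n in sequentially. norm (1 / (1 + (real n)\<^sup>2)) \<le> inverse (real n ^ 2)"
    using eventually_gt_at_top[of 0]
  proof eventually_elim
    case (elim n)
    have "1 / (1 + (real n)\<^sup>2) \<le> 1 / (real n)\<^sup>2"
      using elim by (intro divide_left_mono) (auto intro!: mult_pos_pos add_pos_nonneg)
    then show ?case by (simp add: inverse_eq_divide)
  qed
qed

lemma cauchy_cell_sum_ge: "2 \<le> cauchy_cell_sum"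
proof -
  have "(\<Sum>j\<in>{0}. 1 / (1 + (real j)\<^sup>2)) \<le> (\<Sum>j. 1 / (1 + (real j)\<^sup>2))"
    by (rule sum_le_suminf[OF summable_cauchy_cells]) auto
  then show ?thesis by (simp add: cauchy_cell_sum_def)
qed

text \<open>
  Cutting the line at the points \<open>x + j T\<close>, for integers \<open>j\<close>, turns the integral into a sum over two cells at each distance from \<open>x\<close>,
  one on either side; every cell has mass at most \<open>conc_fun H T\<close>.
\<close>

lemma nn_integral_cauchy_weight_le:
  assumes H: "real_distribution H" and T: "T > 0"
  shows "(\<integral>\<^sup>+ y. ennreal (1 / (1 + ((x - y) / T)\<^sup>2)) \<partial>H) \<le> ennreal (cauchy_cell_sum * conc_fun H T)"
proof -
  interpret real_distribution H by fact
  define A where "A j = {(x + real j * T)..(x + real j * T) + T}" for j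
  define B where "B j = {(x - real (Suc j) * T)..(x - real (Suc j) * T) + T}" for j
  define w where "w j = 1 / (1 + (real j)\<^sup>2)" for j
  have [measurable]: "A j \<in> sets borel" "B j \<in> sets borel" for j by (auto simp: A_def B_def)
  have w0: "0 \<le> w j" for j by (simp add: w_def)
  have "(\<integral>\<^sup>+ y. ennreal (1 / (1 + ((x - y) / T)\<^sup>2)) \<partial>H)
      \<le> (\<integral>\<^sup>+ y. (\<Sum>j. ennreal (w j) * (indicator (A j) y + indicator (B j) y)) \<partial>H)"
  proof (rule nn_integral_mono)
    fix y
    \<comment> \<open>The index of the cell, counted away from x, that contains y.\<close>
    define j where "j = nat \<lfloor>\<bar>y - x\<bar> / T\<rfloor>"
    have "real j \<le> \<bar>y - x\<bar> / T" "\<bar>y - x\<bar> / T < real j + 1"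
      using T by (auto simp: j_def)
    then have j: "j * T \<le> \<bar>y - x\<bar>" "\<bar>y - x\<bar> < (j + 1) * T" "real j \<le> \<bar>(x - y) / T\<bar>"
      using T by (auto simp: field_simps abs_minus_commute)
    have "y \<in> A j \<or> y \<in> B j"
      using j(1,2) by (auto simp: A_def B_def algebra_simps abs_if split: if_splits)
    then have i: "1 \<le> (indicator (A j) y + indicator (B j) y :: ennreal)"
      by (auto simp: indicator_def)
    have "(real j)\<^sup>2 \<le> ((x - y) / T)\<^sup>2"
      using power_mono[OF j(3), of 2] by (simp only: power2_abs of_nat_0_le_iff)
    then have "ennreal (1 / (1 + ((x - y) / T)\<^sup>2)) \<le> ennreal (w j) * 1"
      by (auto simp: w_def intro!: ennreal_leI divide_left_mono mult_pos_pos add_pos_nonneg)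
    also have "\<dots> \<le> ennreal (w j) * (indicator (A j) y + indicator (B j) y)"
      by (intro mult_left_mono i) auto
    also have "\<dots> = (\<Sum>j\<in>{j}. ennreal (w j) * (indicator (A j) y + indicator (B j) y))" by simp
    also have "\<dots> \<le> (\<Sum>j. ennreal (w j) * (indicator (A j) y + indicator (B j) y))"
      by (rule sum_le_suminf) auto
    finally show "ennreal (1 / (1 + ((x - y) / T)\<^sup>2))
        \<le> (\<Sum>j. ennreal (w j) * (indicator (A j) y + indicator (B j) y))" .
  qed
  also have "\<dots> = (\<Sum>j. \<integral>\<^sup>+ y. ennreal (w j) * (indicator (A j) y + indicator (B j) y) \<partial>H)"
    by (rule nn_integral_suminf) measurable
  also have "\<dots> = (\<Sum>j. ennreal (w j) * (emeasure H (A j) + emeasure H (B j)))"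
    by (simp add: nn_integral_cmult nn_integral_add)
  also have "\<dots> \<le> (\<Sum>j. ennreal (w j * (2 * conc_fun H T)))"
  proof (intro suminf_le allI)
    fix j
    have "measure H (A j) + measure H (B j) \<le> 2 * conc_fun H T"
      using measure_le_conc_fun[OF H, of "x + real j * T" T]
        measure_le_conc_fun[OF H, of "x - real (Suc j) * T" T]
      by (simp only: A_def B_def)
    then have "w j * (prob (A j) + prob (B j)) \<le> w j * (2 * conc_fun H T)"
      by (rule mult_left_mono) (rule w0)
    moreover have "ennreal (w j) * (emeasure H (A j) + emeasure H (B j))
        = ennreal (w j * (prob (A j) + prob (B j)))"
      unfolding ennreal_mult'[OF w0] emeasure_eq_measure by simp
    ultimately show "ennreal (w j) * (emeasure H (A j) + emeasure H (B j)) \<le> ennreal (w j * (2 * conc_fun H T))"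
      by (simp only: ennreal_leI)
  qed auto
  also have "\<dots> = ennreal (\<Sum>j. w j * (2 * conc_fun H T))"
  proof (rule suminf_ennreal2)
    show "summable (\<lambda>j. w j * (2 * conc_fun H T))"
      unfolding w_def by (rule summable_mult2[OF summable_cauchy_cells])
    show "0 \<le> w j * (2 * conc_fun H T)" for j
      by (intro mult_nonneg_nonneg w0) (simp_all add: conc_fun_nonneg[OF H])
  qed
  also have "(\<Sum>j. w j * (2 * conc_fun H T)) = (\<Sum>j. w j) * (2 * conc_fun H T)"
    unfolding w_def by (rule suminf_mult2[OF summable_cauchy_cells, symmetric])
  also have "\<dots> = cauchy_cell_sum * conc_fun H T"
    by (simp only: cauchy_cell_sum_def w_def mult_ac)
  finally show ?thesis .
qed

section \<open>Characteristic functions and second moments of convolutions\<close>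

lemma pair_integral_mult:
  fixes g h :: "real \<Rightarrow> 'a::{real_normed_field,banach,second_countable_topology}"
  assumes "sigma_finite_measure M" "sigma_finite_measure N" "integrable M g" "integrable N h"
  shows integrable_pair_mult: "integrable (M \<Otimes>\<^sub>M N) (\<lambda>(x, y). g x * h y)"
    and integral_pair_mult:
      "(LINT z|(M \<Otimes>\<^sub>M N). (case z of (x, y) \<Rightarrow> g x * h y)) = (LINT x|M. g x) * (LINT y|N. h y)"
proof -
  interpret M: sigma_finite_measure M by fact
  interpret N: sigma_finite_measure N by fact
  interpret P: pair_sigma_finite M N ..
  note [measurable] = borel_measurable_integrable[OF assms(3)] borel_measurable_integrable[OF assms(4)]
  show int: "integrable (M \<Otimes>\<^sub>M N) (\<lambda>(x, y). g x * h y)"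
  proof (rule P.Fubini_integrable)
    show "(\<lambda>(x, y). g x * h y) \<in> borel_measurable (M \<Otimes>\<^sub>M N)" by measurable
    show "integrable M (\<lambda>x. LINT y|N. norm (case (x, y) of (x, y) \<Rightarrow> g x * h y))"
      using assms by (simp add: norm_mult)
    show "AE x in M. integrable N (\<lambda>y. case (x, y) of (x, y) \<Rightarrow> g x * h y)"
      using assms by simp
  qed
  have "(LINT x|M. LINT y|N. g x * h y) = (LINT z|(M \<Otimes>\<^sub>M N). (case z of (x, y) \<Rightarrow> g x * h y))"
    using P.integral_fst'[OF int] by simp
  then show "(LINT z|(M \<Otimes>\<^sub>M N). (case z of (x, y) \<Rightarrow> g x * h y)) = (LINT x|M. g x) * (LINT y|N. h y)"
    by simp
qed

lemma integral_convolution: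
  fixes f :: "real \<Rightarrow> 'a::{banach,second_countable_topology}"
  assumes "real_distribution M" "real_distribution N" and [measurable]: "f \<in> borel_measurable borel"
  shows "(LINT x|convolution M N. f x) = (LINT z|(M \<Otimes>\<^sub>M N). (case z of (x, y) \<Rightarrow> f (x + y)))"
    and "integrable (convolution M N) f \<longleftrightarrow> integrable (M \<Otimes>\<^sub>M N) (\<lambda>(x, y). f (x + y))"
proof -
  interpret M: real_distribution M by fact
  interpret N: real_distribution N by fact
  have [measurable]: "(\<lambda>(x, y). x + y) \<in> borel_measurable (M \<Otimes>\<^sub>M N)" by measurable
  show "(LINT x|convolution M N. f x) = (LINT z|(M \<Otimes>\<^sub>M N). (case z of (x, y) \<Rightarrow> f (x + y)))"
    unfolding convolution_def by (subst integral_distr) (auto simp: case_prod_beta')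
  show "integrable (convolution M N) f \<longleftrightarrow> integrable (M \<Otimes>\<^sub>M N) (\<lambda>(x, y). f (x + y))"
    unfolding convolution_def by (subst integrable_distr_eq) (auto simp: case_prod_beta')
qed

lemma integrable_square_convolution:
  assumes M: "real_distribution M" "integrable M (\<lambda>x. x\<^sup>2)"
    and N: "real_distribution N" "integrable N (\<lambda>x. x\<^sup>2)"
  shows "integrable (convolution M N) (\<lambda>x. x\<^sup>2)"
proof -
  interpret M: real_distribution M by fact
  interpret N: real_distribution N by fact
  have sf: "sigma_finite_measure M" "sigma_finite_measure N" by unfold_locales
  have "integrable (M \<Otimes>\<^sub>M N) (\<lambda>(x, y). (x + y)\<^sup>2)"
  proof (rule Bochner_Integration.integrable_bound)
    show "integrable (M \<Otimes>\<^sub>M N) (\<lambda>z. 2 * (case z of (x, y) \<Rightarrow> x\<^sup>2 * 1) + 2 * (case z of (x, y) \<Rightarrow> 1 * y\<^sup>2))"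
      by (intro Bochner_Integration.integrable_add integrable_mult_right integrable_pair_mult sf M N) auto
    show "AE z in M \<Otimes>\<^sub>M N. norm (case z of (x, y) \<Rightarrow> (x + y)\<^sup>2)
        \<le> norm (2 * (case z of (x, y) \<Rightarrow> x\<^sup>2 * 1) + 2 * (case z of (x, y) \<Rightarrow> 1 * y\<^sup>2))"
    proof (intro AE_I2, clarify)
      fix x y :: real
      have "(x + y)\<^sup>2 \<le> 2 * x\<^sup>2 + 2 * y\<^sup>2"
        using sum_squares_bound[of x y] by (simp add: power2_sum)
      moreover have "norm ((x + y)\<^sup>2) = (x + y)\<^sup>2" by (simp only: real_norm_def abs_power2)
      ultimately show "norm ((x + y)\<^sup>2) \<le> norm (2 * (x\<^sup>2 * 1) + 2 * (1 * y\<^sup>2))" by simp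
    qed
  qed simp
  then show ?thesis using M N by (simp add: integral_convolution)
qed

text \<open>
  The \<open>j\<close>-th derivative of the characteristic function, up to the factor \<open>\<i> ^ j\<close>.
\<close>

definition char_moment :: "real measure \<Rightarrow> nat \<Rightarrow> real \<Rightarrow> complex" where
  "char_moment M j t = (CLINT x|M. of_real (x ^ j) * iexp (t * x))"

lemma char_moment_0: "char_moment M 0 t = char M t"
  by (simp add: char_moment_def char_def)

lemma integrable_char_moment:
  assumes "real_distribution M" "integrable M (\<lambda>x. x\<^sup>2)" "j \<le> 2"
  shows "complex_integrable M (\<lambda>x. of_real (x ^ j) * iexp (t * x))"
proof (rule Bochner_Integration.integrable_bound)
  interpret M: real_distribution M by fact
  have "j = 0 \<or> j = 1 \<or> j = 2" using assms(3) by auto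
  then show "integrable M (\<lambda>x. x ^ j)"
    using assms(2) M.square_integrable_imp_integrable[of "\<lambda>x. x"] by auto
qed (use assms(1) in \<open>auto simp: norm_mult norm_power power_abs real_distribution_def real_distribution_axioms_def\<close>)

text \<open>
  The Leibniz rule for the product of two characteristic functions.
\<close>

lemma char_moment_convolution:
  assumes M: "real_distribution M" "integrable M (\<lambda>x. x\<^sup>2)"
    and N: "real_distribution N" "integrable N (\<lambda>x. x\<^sup>2)"
  shows "char (convolution M N) t = char M t * char N t"
    and "char_moment (convolution M N) 1 t
      = char_moment M 1 t * char N t + char M t * char_moment N 1 t"
    and "char_moment (convolution M N) 2 t
      = char_moment M 2 t * char N t + 2 * char_moment M 1 t * char_moment N 1 t
        + char M t * char_moment N 2 t"
proof -
  interpret M: real_distribution M by fact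
  interpret N: real_distribution N by fact
  have sf: "sigma_finite_measure M" "sigma_finite_measure N" by unfold_locales
  define e where "e j x = of_real (x ^ j) * iexp (t * x)" for j and x :: real
  have [measurable]: "e j \<in> borel_measurable borel" for j unfolding e_def by measurable
  have iM: "complex_integrable M (e j)" if "j \<le> 2" for j
    unfolding e_def by (rule integrable_char_moment[OF M that])
  have iN: "complex_integrable N (e j)" if "j \<le> 2" for j
    unfolding e_def by (rule integrable_char_moment[OF N that])
  have cm: "char_moment L j t = (CLINT x|L. e j x)" for L j
    by (simp add: char_moment_def e_def)
  note pair = integral_pair_mult[OF sf iM iN] integrable_pair_mult[OF sf iM iN]
  have e0: "e 0 (x + y) = e 0 x * e 0 y"
    and e1: "e 1 (x + y) = e 1 x * e 0 y + e 0 x * e 1 y"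
    and e2: "e 2 (x + y) = e 2 x * e 0 y + 2 * (e 1 x * e 1 y) + e 0 x * e 2 y" for x y
    by (simp_all add: e_def algebra_simps power2_eq_square exp_add)
  show "char (convolution M N) t = char M t * char N t"
    unfolding char_moment_0[symmetric] cm
    by (simp add: integral_convolution[OF M(1) N(1)] e0 pair)
  show "char_moment (convolution M N) 1 t
      = char_moment M 1 t * char N t + char M t * char_moment N 1 t"
    unfolding char_moment_0[symmetric] cm
    using pair[of 1 0] pair[of 0 1]
    by (simp add: integral_convolution[OF M(1) N(1)] e1 case_prod_beta' del: One_nat_def)
  show "char_moment (convolution M N) 2 t
      = char_moment M 2 t * char N t + 2 * char_moment M 1 t * char_moment N 1 t
        + char M t * char_moment N 2 t"
    unfolding char_moment_0[symmetric] cm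
    using pair[of 2 0] pair[of 0 2] pair[of 1 1]
    by (simp add: integral_convolution[OF M(1) N(1)] e2 case_prod_beta' del: One_nat_def)
qed

lemma integrable_square_conv_power:
  assumes "real_distribution U" "integrable U (\<lambda>x. x\<^sup>2)"
  shows "integrable (conv_power U n) (\<lambda>x. x\<^sup>2)"
proof (induction n)
  case 0
  interpret real_distribution "return borel (0::real)"
    using real_distribution_conv_power[OF assms(1), of 0] by simp
  show ?case
    by (auto intro!: integrable_const_bound[of _ 0] simp: AE_return)
next
  case (Suc n)
  then show ?case
    using assms by (simp add: integrable_square_convolution real_distribution_conv_power)
qed

text \<open>
  The first two derivatives of the \<open>n\<close>-th power of a function. For \<open>n < 2\<close> the truncated exponents are
  harmless, since the coefficients in front of them vanish.
\<close>

lemma char_moment_conv_power: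
  assumes U: "real_distribution U" "integrable U (\<lambda>x. x\<^sup>2)"
  shows "char (conv_power U n) t = char U t ^ n"
    and "char_moment (conv_power U n) 1 t = of_nat n * char U t ^ (n - 1) * char_moment U 1 t"
    and "char_moment (conv_power U n) 2 t = of_nat n * char U t ^ (n - 1) * char_moment U 2 t
      + of_nat (n * (n - 1)) * char U t ^ (n - 2) * (char_moment U 1 t)\<^sup>2"
proof (induction n)
  case 0
  { case 1 show ?case by (simp add: char_def integral_return) }
  { case 2 show ?case by (simp add: char_moment_def integral_return) }
  { case 3 show ?case by (simp add: char_moment_def integral_return) }
next
  case (Suc n)
  note conv = char_moment_convolution[OF U real_distribution_conv_power[OF U(1)]
      integrable_square_conv_power[OF U], of n t]
  { case 1 show ?case using Suc by (simp add: conv) }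
  { case 2 show ?case
      using Suc.IH unfolding conv_power.simps conv
      by (cases n) (simp_all add: algebra_simps) }
  { case 3 show ?case
      using Suc.IH unfolding conv_power.simps conv
      by (cases n; cases "n - 1") (simp_all add: algebra_simps power2_eq_square) }
qed

lemma norm_char_moment_le:
  assumes U: "real_distribution U" "integrable U (\<lambda>x. x\<^sup>2)" and m: "(LINT x|U. x) = 0"
  shows "norm (char_moment U 1 t) \<le> \<bar>t\<bar> * (LINT x|U. x\<^sup>2)"
    and "norm (char_moment U 2 t) \<le> (LINT x|U. x\<^sup>2)"
proof -
  interpret U: real_distribution U by fact
  have i1: "complex_integrable U (\<lambda>x. of_real x * iexp (t * x))"
    using integrable_char_moment[OF U, of 1 t] by simp
  have i0: "integrable U (\<lambda>x. x)" using U.square_integrable_imp_integrable[of "\<lambda>x. x"] U(2) by simp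
  \<comment> \<open>Subtracting the vanishing mean replaces the exponential by its increment, which is
    at most the absolute value of t x; this is where centring is used.\<close>
  have "char_moment U 1 t = (CLINT x|U. of_real x * iexp (t * x)) - of_real (LINT x|U. x)"
    by (simp add: char_moment_def m)
  also have "\<dots> = (CLINT x|U. of_real x * iexp (t * x) - of_real x)"
    using i1 integrable_of_real[OF i0, where 'a = complex] by simp
  finally have eq: "char_moment U 1 t = (CLINT x|U. of_real x * (iexp (t * x) - 1))"
    by (simp only: right_diff_distrib mult_1_right)
  have "norm (char_moment U 1 t) \<le> (LINT x|U. \<bar>t\<bar> * x\<^sup>2)"
    unfolding eq
  proof (rule Bochner_Integration.integral_norm_bound_integral)
    fix x
    have "norm (iexp (t * x) - 1) \<le> \<bar>t * x\<bar>"
      using iexp_approx1[of "t * x" 0] by simp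
    then show "norm (of_real x * (iexp (t * x) - 1)) \<le> \<bar>t\<bar> * x\<^sup>2"
      using mult_left_mono[of "norm (iexp (t * x) - 1)" "\<bar>t * x\<bar>" "\<bar>x\<bar>"]
      by (simp add: norm_mult abs_mult power2_eq_square mult_ac)
  next
    have "complex_integrable U (\<lambda>x. of_real x * iexp (t * x) - of_real x)"
      using i1 integrable_of_real[OF i0, where 'a = complex] by simp
    then show "complex_integrable U (\<lambda>x. of_real x * (iexp (t * x) - 1))"
      by (simp add: right_diff_distrib)
    show "integrable U (\<lambda>x. \<bar>t\<bar> * x\<^sup>2)" using U by simp
  qed
  then show "norm (char_moment U 1 t) \<le> \<bar>t\<bar> * (LINT x|U. x\<^sup>2)" by simp
  show "norm (char_moment U 2 t) \<le> (LINT x|U. x\<^sup>2)"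
    unfolding char_moment_def
    by (rule Bochner_Integration.integral_norm_bound_integral) (use integrable_char_moment[OF U, of 2 t] U(2) in \<open>auto simp: norm_mult norm_power\<close>)
qed

section \<open>A weighted smoothing inequality\<close>

text \<open>
  Half the Fourier transform of the triangle function on \<open>[-a, a]\<close>, hence a Fejer kernel, written as a
  cosine integral so that only real integrals occur.
\<close>

definition fejer :: "real \<Rightarrow> real \<Rightarrow> real" where
  "fejer a x = (LINT t|lborel. ((1 - t / a) * cos (t * x)) * indicator {0..a} t)"

lemma fejer_nonneg:
  assumes "a > 0"
  shows "fejer a x \<ge> 0"
proof (cases "x = 0")
  case True
  have "fejer a x = (LINT t|lborel. (1 - t / a) * indicator {0..a} t)"
    by (simp add: fejer_def True)
  also have "\<dots> \<ge> 0"
    using assms by (intro integral_nonneg_AE AE_I2) (auto split: split_indicator simp: divide_simps)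
  finally show ?thesis .
next
  case False
  \<comment> \<open>Integrating by parts shows that the kernel equals (1 - cos(a x)) / (a x^2).\<close>
  define P where "P t = (1 - t / a) * sin (t * x) / x - cos (t * x) / (a * x\<^sup>2)" for t
  have "fejer a x = P a - P 0"
    unfolding fejer_def
  proof (rule integral_FTC_Icc_real)
    show "DERIV P t :> (1 - t / a) * cos (t * x)" for t
      unfolding P_def using False assms
      by (auto intro!: derivative_eq_intros simp: field_simps power2_eq_square)
  qed (use assms in \<open>auto intro!: continuous_intros\<close>)
  also have "\<dots> = (1 - cos (a * x)) / (a * x\<^sup>2)"
    using assms False by (simp add: P_def field_simps)
  also have "\<dots> \<ge> 0" using assms by simp
  finally show ?thesis .
qed

lemma integrable_fejer_integrand:
  fixes a x :: real
  assumes "a > 0"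
  shows "integrable lborel (\<lambda>t. ((1 - t / a) * cos (t * x)) * indicator {0..a} t)"
proof -
  have "integrable lborel (\<lambda>t. indicator {0..a} t *\<^sub>R ((1 - t / a) * cos (t * x)))"
    using assms by (intro borel_integrable_compact) (auto intro!: continuous_intros)
  then show ?thesis by (simp add: mult.commute)
qed

lemma fejer_lower_bound:
  assumes "a > 0" "0 \<le> x" "a * x \<le> 1"
  shows "a / 4 \<le> fejer a x"
proof -
  define P :: "real \<Rightarrow> real" where "P t = (t - t\<^sup>2 / (2 * a)) / 2" for t
  have bint: "has_bochner_integral lborel (\<lambda>t. ((1 - t / a) / 2) * indicator {0..a} t) (P a - P 0)"
  proof (rule has_bochner_integral_FTC_Icc_real)
    show "DERIV P t :> (1 - t / a) / 2" for t
      unfolding P_def using assms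
      by (auto intro!: derivative_eq_intros simp: field_simps power2_eq_square)
  qed (use assms in \<open>auto intro!: continuous_intros\<close>)
  have "a / 4 = P a - P 0"
    using assms by (simp add: P_def power2_eq_square)
  also have "\<dots> = (LINT t|lborel. ((1 - t / a) / 2) * indicator {0..a} t)"
    using bint by (simp add: has_bochner_integral_iff)
  also have "\<dots> \<le> fejer a x"
    unfolding fejer_def
  proof (rule integral_mono)
    show "integrable lborel (\<lambda>t. ((1 - t / a) / 2) * indicator {0..a} t)"
      using bint by (simp add: has_bochner_integral_iff)
    show "integrable lborel (\<lambda>t. ((1 - t / a) * cos (t * x)) * indicator {0..a} t)"
      by (rule integrable_fejer_integrand) fact
    fix t :: real
    show "((1 - t / a) / 2) * indicator {0..a} t \<le> ((1 - t / a) * cos (t * x)) * indicator {0..a} t"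
    proof (cases "t \<in> {0..a}")
      case True
      then have "0 \<le> t * x" "t * x \<le> 1"
        using assms mult_right_mono[of t a x] by auto
      \<comment> \<open>The phase stays below 1 < pi/3, so the cosine never drops below 1/2.\<close>
      then have "cos (t * x) \<ge> cos (pi / 3)"
        using pi_gt3 pi_less_4 by (intro cos_monotone_0_pi_le) auto
      then have "1 / 2 \<le> cos (t * x)" by (simp add: cos_60)
      then have "(1 - t / a) * (1 / 2) \<le> (1 - t / a) * cos (t * x)"
        using True assms by (intro mult_left_mono) (auto simp: divide_simps)
      then show ?thesis using True by simp
    qed simp
  qed
  finally show ?thesis .
qed

text \<open>
  The kernel is nonnegative and at least \<open>a / 4\<close> on \<open>[0, b]\<close>, so \<open>a / 4\<close> times the weighted mass of the interval
  is at most the weighted mean of \<open>fejer a (s - u)\<close>. By Fubini's theorem that mean is a Fourier integral over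
  frequencies below \<open>a\<close>. In contrast to the usual bound for concentration functions the measure carries a
  weight \<open>w\<close>; a growing weight gives decay in the position \<open>u\<close>.
\<close>

lemma smoothing_inequality:
  fixes w B :: "real \<Rightarrow> real"
  assumes M: "real_distribution M" and w: "integrable M w" "\<And>s. 0 \<le> w s"
    and a: "a > 0" "a * b \<le> 1"
    and B: "integrable lborel B" "\<And>t. 0 \<le> B t"
    and bound: "\<And>t. 0 < t \<Longrightarrow> t \<le> a \<Longrightarrow> norm (CLINT s|M. of_real (w s) * iexp (t * s)) \<le> B t"
  shows "(LINT s|M. w s * indicator {u..u + b} s) * (a / 4) \<le> (LINT t|lborel. B t)"
proof -
  interpret M: real_distribution M by fact
  interpret P: pair_sigma_finite M lborel ..
  note [measurable] = borel_measurable_integrable[OF w(1)]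
  define h where "h t = (1 - t / a) * indicator {0..a} t" for t :: real
  have hm [measurable]: "h \<in> borel_measurable borel" unfolding h_def by measurable
  have hi: "integrable lborel h"
    unfolding h_def using integrable_fejer_integrand[OF a(1), of 0] by simp
  have h01: "0 \<le> h t" "h t \<le> 1" for t
    using a by (auto simp: h_def divide_simps split: split_indicator)
  define f where "f s t = w s * (h t * cos (t * (s - u)))" for s t
  have f_int: "integrable (M \<Otimes>\<^sub>M lborel) (\<lambda>(s, t). f s t)"
  proof (rule Bochner_Integration.integrable_bound)
    show "integrable (M \<Otimes>\<^sub>M lborel) (\<lambda>(s, t). w s * h t)"
      by (rule integrable_pair_mult) (use w hi in \<open>auto intro: M.sigma_finite_measure sigma_finite_lborel\<close>)
    show "(\<lambda>(s, t). f s t) \<in> borel_measurable (M \<Otimes>\<^sub>M lborel)"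
      unfolding f_def by measurable
    show "AE z in M \<Otimes>\<^sub>M lborel. norm (case z of (s, t) \<Rightarrow> f s t) \<le> norm (case z of (s, t) \<Rightarrow> w s * h t)"
      by (auto simp: f_def abs_mult intro!: AE_I2 mult_left_mono mult_left_le abs_cos_le_one)
  qed
  have fej: "w s * fejer a (s - u) = (LINT t|lborel. f s t)" for s
    by (simp add: f_def fejer_def h_def mult_ac)
  have iw: "integrable M (\<lambda>s. w s * fejer a (s - u))"
    unfolding fej using P.integrable_fst'[OF f_int] by simp
  have "(LINT s|M. w s * indicator {u..u + b} s) * (a / 4)
      = (LINT s|M. w s * indicator {u..u + b} s * (a / 4))" by simp
  also have "\<dots> \<le> (LINT s|M. w s * fejer a (s - u))"
  proof (rule integral_mono)
    show "integrable M (\<lambda>s. w s * indicator {u..u + b} s * (a / 4))"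
      using w(1) by (intro integrable_mult_left integrable_real_mult_indicator) auto
    fix s
    show "w s * indicator {u..u + b} s * (a / 4) \<le> w s * fejer a (s - u)"
    proof (cases "s \<in> {u..u + b}")
      case True
      then have "a * (s - u) \<le> a * b" using a by (intro mult_left_mono) auto
      then have "a * (s - u) \<le> 1" using a by linarith
      then show ?thesis using True mult_left_mono[OF fejer_lower_bound[OF a(1), of "s - u"] w(2)[of s]]
        by simp
    next
      case False
      then show ?thesis using w(2) fejer_nonneg[OF a(1)] by simp
    qed
  qed (rule iw)
  also have "\<dots> = (LINT s|M. LINT t|lborel. f s t)" by (simp only: fej)
  also have "\<dots> = (LINT t|lborel. LINT s|M. f s t)"
    by (rule P.Fubini_integral[symmetric]) (use f_int in \<open>simp add: case_prod_beta'\<close>)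
  also have "\<dots> \<le> (LINT t|lborel. B t)"
  proof (rule integral_mono_AE)
    show "integrable lborel (\<lambda>t. LINT s|M. f s t)"
      using P.integrable_snd[OF f_int] by simp
    show "AE t in lborel. (LINT s|M. f s t) \<le> B t"
      using AE_lborel_singleton[of 0]
    proof eventually_elim
      case (elim t)
      show ?case
      proof (cases "t \<in> {0..a}")
        case False
        then show ?thesis using B by (simp add: f_def h_def)
      next
        case True
        have ci: "complex_integrable M (\<lambda>s. of_real (w s) * iexp (t * s))"
          by (rule Bochner_Integration.integrable_bound[OF w(1)]) (auto simp: norm_mult)
        \<comment> \<open>The shift by u only rotates the Fourier integral, hence disappears in absolute value.\<close>
        have Re_eq: "w s * cos (t * (s - u)) = Re (iexp (- (t * u)) * (of_real (w s) * iexp (t * s)))" for s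
          by (simp add: algebra_simps cos_diff Re_exp Im_exp)
        have "(LINT s|M. f s t) = h t * (LINT s|M. w s * cos (t * (s - u)))"
          by (simp add: f_def mult_ac flip: integral_mult_right_zero)
        also have "(LINT s|M. w s * cos (t * (s - u)))
            = Re (iexp (- (t * u)) * (CLINT s|M. of_real (w s) * iexp (t * s)))"
          unfolding Re_eq by (subst integral_Re) (use ci in auto)
        also have "h t * \<dots> \<le> 1 * norm (iexp (- (t * u)) * (CLINT s|M. of_real (w s) * iexp (t * s)))"
          by (rule order_trans[OF mult_left_mono[OF complex_Re_le_cmod] mult_right_mono]) (auto simp: h01)
        also have "\<dots> = norm (CLINT s|M. of_real (w s) * iexp (t * s))"
          by (simp only: norm_mult mult_1_left norm_exp_i_times)
        also have "\<dots> \<le> B t" using True elim by (intro bound) auto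
        finally show ?thesis .
      qed
    qed
  qed (rule B)
  finally show ?thesis .
qed

section \<open>Gaussian decay of the characteristic function\<close>

lemma integrable_truncated_moment:
  assumes "real_distribution U" "integrable U (\<lambda>x. x\<^sup>2)" "T \<ge> 0"
  shows "integrable U (\<lambda>x. x\<^sup>2 * min \<bar>x\<bar> T)"
proof (rule Bochner_Integration.integrable_bound)
  interpret real_distribution U by fact
  show "integrable U (\<lambda>x. x\<^sup>2 * T)" using assms by simp
  show "(\<lambda>x. x\<^sup>2 * min \<bar>x\<bar> T) \<in> borel_measurable U" by measurable
  show "AE x in U. norm (x\<^sup>2 * min \<bar>x\<bar> T) \<le> norm (x\<^sup>2 * T)"
    using assms(3) by (auto simp: abs_mult intro!: mult_left_mono)
qed

lemma trunc_moment_mono: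
  assumes "real_distribution U" "integrable U (\<lambda>x. x\<^sup>2)" "\<sigma> \<ge> 0" "k \<le> n"
  shows "trunc_moment U \<sigma> k \<le> trunc_moment U \<sigma> n"
proof -
  have "\<sigma> * sqrt k \<le> \<sigma> * sqrt n" using assms by (intro mult_left_mono) auto
  then show ?thesis
    unfolding trunc_moment_def using assms
    by (intro integral_mono integrable_truncated_moment) (auto intro!: mult_left_mono)
qed

lemma trunc_moment_lower_bound:
  assumes U: "real_distribution U" "integrable U (\<lambda>x. x\<^sup>2)"
    and \<sigma>: "\<sigma> > 0" "\<sigma>\<^sup>2 = (LINT x|U. x\<^sup>2)" and n: "n \<ge> 1"
  shows "3 / 8 * \<sigma> * \<sigma>\<^sup>2 \<le> trunc_moment U \<sigma> n"
proof -
  interpret U: real_distribution U by fact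
  have [simp]: "U.prob UNIV = 1" by (metis U.prob_space U.space_eq_univ)
  have "\<sigma> * 1 \<le> \<sigma> * sqrt n" using n \<sigma> by (intro mult_left_mono) auto
  then have T: "\<sigma> \<le> \<sigma> * sqrt n" by simp
  have "3 / 8 * \<sigma> * \<sigma>\<^sup>2 = (LINT x|U. \<sigma> / 2 * (x\<^sup>2 - \<sigma>\<^sup>2 / 4))"
    using U \<sigma>(2) by simp
  also have "\<dots> \<le> trunc_moment U \<sigma> n"
    unfolding trunc_moment_def
  proof (intro integral_mono integrable_truncated_moment U)
    fix x :: real
    \<comment> \<open>Where |x| >= sigma/2 the truncated factor is at least sigma/2, elsewhere the left-hand
      side is nonpositive.\<close>
    show "\<sigma> / 2 * (x\<^sup>2 - \<sigma>\<^sup>2 / 4) \<le> x\<^sup>2 * min \<bar>x\<bar> (\<sigma> * sqrt n)"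
    proof (cases "\<sigma> / 2 \<le> \<bar>x\<bar>")
      case True
      then have "\<sigma> / 2 \<le> min \<bar>x\<bar> (\<sigma> * sqrt n)" using T \<sigma>(1) by linarith
      then have "x\<^sup>2 * (\<sigma> / 2) \<le> x\<^sup>2 * min \<bar>x\<bar> (\<sigma> * sqrt n)"
        by (rule mult_left_mono) simp
      moreover have "\<sigma> / 2 * (x\<^sup>2 - \<sigma>\<^sup>2 / 4) \<le> \<sigma> / 2 * x\<^sup>2"
        using \<sigma> by (intro mult_left_mono) auto
      ultimately show ?thesis by (simp add: mult.commute)
    next
      case False
      then have "x\<^sup>2 \<le> (\<sigma> / 2)\<^sup>2"
        using power_mono[of "\<bar>x\<bar>" "\<sigma> / 2" 2] by simp
      then have "\<sigma> / 2 * (x\<^sup>2 - \<sigma>\<^sup>2 / 4) \<le> 0"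
        using \<sigma> by (intro mult_nonneg_nonpos) (auto simp: power_divide)
      also have "0 \<le> x\<^sup>2 * min \<bar>x\<bar> (\<sigma> * sqrt n)" using \<sigma> by simp
      finally show ?thesis .
    qed
  qed (use U \<sigma> in simp_all)
  finally show ?thesis .
qed

text \<open>
  The lower bound on the truncated moment makes \<open>b\<close> at least of the order of \<open>\<sigma>\<close>, so that \<open>\<sigma> t\<close> is bounded for all
  frequencies \<open>t\<close> of order at most \<open>1 / b\<close>.
\<close>

lemma std_dev_le_of_trunc_moment_le:
  assumes U: "real_distribution U" "integrable U (\<lambda>x. x\<^sup>2)"
    and \<sigma>: "\<sigma> > 0" "\<sigma>\<^sup>2 = (LINT x|U. x\<^sup>2)" and n: "n \<ge> 1"
    and b: "trunc_moment U \<sigma> n \<le> b * \<sigma>\<^sup>2"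
  shows "3 / 8 * \<sigma> \<le> b"
proof -
  have "3 / 8 * \<sigma> * \<sigma>\<^sup>2 \<le> b * \<sigma>\<^sup>2"
    using trunc_moment_lower_bound[OF U \<sigma> n] b by linarith
  then show ?thesis using \<sigma>(1) by simp
qed

text \<open>
  The second-order expansion of the characteristic function has an error of at most \<open>|t|\<^sup>3\<close> times the
  truncated third moment as soon as \<open>|t| T \<ge> 1\<close>. For \<open>|t| b \<le> 1 / 4\<close> this is at most half of the quadratic term,
  and the other half is left over as decay.
\<close>

lemma norm_char_le_exp:
  assumes U: "real_distribution U" "integrable U (\<lambda>x. x\<^sup>2)" and m: "(LINT x|U. x) = 0"
    and \<sigma>: "\<sigma>\<^sup>2 = (LINT x|U. x\<^sup>2)"
    and \<kappa>: "(LINT x|U. x\<^sup>2 * min \<bar>x\<bar> T) \<le> b * \<sigma>\<^sup>2" and T: "T > 0"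
    and t: "1 \<le> \<bar>t\<bar> * T" "\<bar>t\<bar> * b \<le> 1 / 4" "t\<^sup>2 * \<sigma>\<^sup>2 \<le> 2"
  shows "norm (char U t) \<le> exp (- (\<sigma>\<^sup>2 * t\<^sup>2 / 4))"
proof -
  interpret U: real_distribution U by fact
  have i0: "integrable U (\<lambda>x. x)" using U.square_integrable_imp_integrable[of "\<lambda>x. x"] U(2) by simp
  have iT: "integrable U (\<lambda>x. x\<^sup>2 * min \<bar>x\<bar> T)"
    using U T by (intro integrable_truncated_moment) auto
  have "norm (char U t - (1 - t\<^sup>2 * \<sigma>\<^sup>2 / 2))
      \<le> t\<^sup>2 / 6 * (LINT x|U. min (6 * x\<^sup>2) (\<bar>t\<bar> * \<bar>x\<bar> ^ 3))"
    using U.char_approx3[OF i0 m U(2)] m \<sigma> by simp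
  also have "(LINT x|U. min (6 * x\<^sup>2) (\<bar>t\<bar> * \<bar>x\<bar> ^ 3)) \<le> (LINT x|U. 6 * \<bar>t\<bar> * (x\<^sup>2 * min \<bar>x\<bar> T))"
  proof (rule integral_mono)
    show "integrable U (\<lambda>x. min (6 * x\<^sup>2) (\<bar>t\<bar> * \<bar>x\<bar> ^ 3))"
      by (rule Bochner_Integration.integrable_bound[of _ "\<lambda>x. 6 * x\<^sup>2"]) (use U in auto)
    show "integrable U (\<lambda>x. 6 * \<bar>t\<bar> * (x\<^sup>2 * min \<bar>x\<bar> T))" using iT by simp
    fix x :: real
    \<comment> \<open>Above the level T the quadratic alternative is used; it is absorbed because |t| T >= 1.\<close>
    show "min (6 * x\<^sup>2) (\<bar>t\<bar> * \<bar>x\<bar> ^ 3) \<le> 6 * \<bar>t\<bar> * (x\<^sup>2 * min \<bar>x\<bar> T)"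
    proof (cases "\<bar>x\<bar> \<le> T")
      case True
      have "\<bar>t\<bar> * \<bar>x\<bar> ^ 3 \<le> 6 * \<bar>t\<bar> * (\<bar>x\<bar> ^ 3)" by (intro mult_right_mono) auto
      then show ?thesis using True
        by (simp add: min_le_iff_disj power3_eq_cube power2_eq_square abs_mult_self_eq)
    next
      case False
      have "x\<^sup>2 * 1 \<le> x\<^sup>2 * (\<bar>t\<bar> * T)" using t(1) by (intro mult_left_mono) auto
      then show ?thesis using False by (simp add: min_le_iff_disj mult_ac)
    qed
  qed
  also have "\<dots> = 6 * \<bar>t\<bar> * (LINT x|U. x\<^sup>2 * min \<bar>x\<bar> T)" by simp
  also have "t\<^sup>2 / 6 * (6 * \<bar>t\<bar> * (LINT x|U. x\<^sup>2 * min \<bar>x\<bar> T)) \<le> t\<^sup>2 / 6 * (6 * \<bar>t\<bar> * (b * \<sigma>\<^sup>2))"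
    using \<kappa> by (intro mult_left_mono) auto
  also have "\<dots> = t\<^sup>2 * \<sigma>\<^sup>2 * (\<bar>t\<bar> * b)" by simp
  also have "\<dots> \<le> t\<^sup>2 * \<sigma>\<^sup>2 * (1 / 4)" using t by (intro mult_left_mono) auto
  finally have "norm (char U t - (1 - t\<^sup>2 * \<sigma>\<^sup>2 / 2)) \<le> t\<^sup>2 * \<sigma>\<^sup>2 / 4"
    by (simp add: mult_left_mono)
  moreover have "norm (1 - t\<^sup>2 * \<sigma>\<^sup>2 / 2 :: complex) = 1 - t\<^sup>2 * \<sigma>\<^sup>2 / 2"
  proof -
    have "(1 - t\<^sup>2 * \<sigma>\<^sup>2 / 2 :: complex) = of_real (1 - t\<^sup>2 * \<sigma>\<^sup>2 / 2)" by simp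
    then show ?thesis using t(3) by (simp only: norm_of_real)
  qed
  moreover have "norm (char U t) \<le> norm (char U t - (1 - t\<^sup>2 * \<sigma>\<^sup>2 / 2)) + norm (1 - t\<^sup>2 * \<sigma>\<^sup>2 / 2 :: complex)"
    using norm_triangle_sub[of "char U t" "1 - t\<^sup>2 * \<sigma>\<^sup>2 / 2"] by simp
  ultimately have "norm (char U t) \<le> 1 - \<sigma>\<^sup>2 * t\<^sup>2 / 4" by (simp add: mult.commute)
  also have "\<dots> \<le> exp (- (\<sigma>\<^sup>2 * t\<^sup>2 / 4))" using exp_ge_add_one_self[of "- (\<sigma>\<^sup>2 * t\<^sup>2 / 4)"] by simp
  finally show ?thesis .
qed

text \<open>
  The exponent \<open>k\<close> may fall short of \<open>n\<close> by 2 because differentiating the \<open>n\<close>-th power of the characteristic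
  function twice removes up to two factors.
\<close>

lemma norm_char_power_le_gauss:
  assumes U: "real_distribution U" "integrable U (\<lambda>x. x\<^sup>2)" and m: "(LINT x|U. x) = 0"
    and \<sigma>: "\<sigma> > 0" "\<sigma>\<^sup>2 = (LINT x|U. x\<^sup>2)" and n: "n \<ge> 1" "n \<le> k + 2"
    and b: "trunc_moment U \<sigma> n \<le> b * \<sigma>\<^sup>2" "3 / 8 * \<sigma> \<le> b"
    and t: "0 < t" "t * b \<le> 1 / 4"
  shows "norm (char U t) ^ k \<le> 2 * exp (- (n * \<sigma>\<^sup>2 * t\<^sup>2 / 4))"
proof -
  interpret U: real_distribution U by fact
  have e2: "exp (1 / 2 :: real) \<le> 2"
  proof -
    have "(exp (1 / 2 :: real))\<^sup>2 = exp 1" by (simp flip: exp_of_nat_mult add: exp_double[symmetric])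
    also have "\<dots> \<le> 2\<^sup>2" using exp_le by simp
    finally show ?thesis by (rule power2_le_imp_le) simp
  qed
  \<comment> \<open>Since sigma is at most 8b/3 and t b at most 1/4, the number q lies in the unit interval;
    dropping up to two factors then costs at most exp(1/2).\<close>
  define q where "q = \<sigma>\<^sup>2 * t\<^sup>2"
  have "t * \<sigma> \<le> t * (8 / 3 * b)" using t b by (intro mult_left_mono) auto
  also have "\<dots> = 8 / 3 * (t * b)" by simp
  finally have "t * \<sigma> \<le> 2 / 3" using t by linarith
  then have "(t * \<sigma>)\<^sup>2 \<le> (2 / 3)\<^sup>2" using t \<sigma> by (intro power_mono) auto
  then have q: "0 \<le> q" "q \<le> 1" by (auto simp: q_def power_mult_distrib mult.commute power_divide)
  have "norm (char U t) ^ k \<le> exp (1 / 2) * exp (- (n * q / 4))"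
  proof (cases "1 \<le> t * (\<sigma> * sqrt n)")
    case True
    have "norm (char U t) \<le> exp (- (\<sigma>\<^sup>2 * t\<^sup>2 / 4))"
      by (rule norm_char_le_exp[OF U m \<sigma>(2), of "\<sigma> * sqrt n" b])
         (use b t True q n \<sigma> in \<open>auto simp: trunc_moment_def q_def mult.commute\<close>)
    then have "norm (char U t) ^ k \<le> exp (- (q / 4)) ^ k"
      unfolding q_def by (intro power_mono) auto
    also have "\<dots> = exp (- (k * q / 4))" by (simp flip: exp_of_nat_mult)
    also have "\<dots> \<le> exp (1 / 2 - n * q / 4)"
    proof -
      have "real n * q \<le> (real k + 2) * q" using n q by (intro mult_right_mono) auto
      then show ?thesis using q by (simp add: algebra_simps)
    qed
    finally show ?thesis by (simp flip: exp_add)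
  next
    case False
    then have "(t * (\<sigma> * sqrt n))\<^sup>2 \<le> 1\<^sup>2" using t \<sigma> by (intro power_mono) auto
    then have "n * q \<le> 1" by (simp add: q_def power_mult_distrib mult_ac)
    then have "0 \<le> 1 / 2 - n * q / 4" by linarith
    then have "1 \<le> exp (1 / 2 - n * q / 4)" by (simp only: one_le_exp_iff)
    moreover have "exp (1 / 2 - n * q / 4) = exp (1 / 2) * exp (- (n * q / 4))"
      by (simp flip: exp_add)
    moreover have "norm (char U t) ^ k \<le> 1" by (intro power_le_one U.cmod_char_le_1) auto
    ultimately show ?thesis by linarith
  qed
  also have "\<dots> \<le> 2 * exp (- (n * q / 4))" using e2 by (intro mult_right_mono) auto
  finally show ?thesis by (simp add: q_def mult.assoc)
qed

section \<open>Small intervals under a convolution power\<close>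

lemma gauss_integral:
  fixes T :: real
  assumes "T > 0"
  shows "integrable lborel (\<lambda>t. exp (- (T\<^sup>2 * t\<^sup>2 / 8)))"
    and "(LINT t|lborel. exp (- (T\<^sup>2 * t\<^sup>2 / 8))) \<le> 6 / T"
proof -
  \<comment> \<open>Up to normalisation this is the density of the centred normal law with deviation 2/T.\<close>
  have eq: "exp (- (T\<^sup>2 * t\<^sup>2 / 8)) = sqrt (8 * pi / T\<^sup>2) * normal_density 0 (2 / T) t" for t
    using assms by (simp add: normal_density_def power_divide field_simps)
  show "integrable lborel (\<lambda>t. exp (- (T\<^sup>2 * t\<^sup>2 / 8)))"
    unfolding eq using assms by simp
  have "(LINT t|lborel. exp (- (T\<^sup>2 * t\<^sup>2 / 8))) = sqrt (8 * pi / T\<^sup>2)"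
    unfolding eq using assms by simp
  also have "\<dots> = sqrt (8 * pi) / T" using assms by (simp add: real_sqrt_divide)
  also have "\<dots> \<le> 6 / T"
    using assms pi_less_4 by (intro divide_right_mono real_le_lsqrt) auto
  finally show "(LINT t|lborel. exp (- (T\<^sup>2 * t\<^sup>2 / 8))) \<le> 6 / T" .
qed

text \<open>
  The weight \<open>1 + (s / T)\<^sup>2\<close> is scaled so that no power of \<open>n\<close> survives: with \<open>T\<^sup>2 = n \<sigma>\<^sup>2\<close> the second derivative of the
  \<open>n\<close>-th power of the characteristic function, divided by \<open>T\<^sup>2\<close>, is at most a Gaussian times a polynomial in \<open>T t\<close>.
\<close>

lemma weighted_char_conv_power_le:
  assumes U: "real_distribution U" "integrable U (\<lambda>x. x\<^sup>2)" and m: "(LINT x|U. x) = 0"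
    and \<sigma>: "\<sigma> > 0" "\<sigma>\<^sup>2 = (LINT x|U. x\<^sup>2)" and n: "n \<ge> 1"
    and b: "trunc_moment U \<sigma> n \<le> b * \<sigma>\<^sup>2" "3 / 8 * \<sigma> \<le> b"
    and t: "0 < t" "t * b \<le> 1 / 4" and T: "T = \<sigma> * sqrt n"
  shows "norm (CLINT s|conv_power U n. of_real (1 + (s / T)\<^sup>2) * iexp (t * s))
    \<le> 16 * exp (- (T\<^sup>2 * t\<^sup>2 / 8))"
proof -
  interpret U: real_distribution U by fact
  let ?M = "conv_power U n"
  have M: "real_distribution ?M" "integrable ?M (\<lambda>x. x\<^sup>2)"
    using U by (auto intro: real_distribution_conv_power integrable_square_conv_power)
  have T0: "T > 0" and T2: "T\<^sup>2 = n * \<sigma>\<^sup>2" using \<sigma> n by (auto simp: T power_mult_distrib)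
  define G where "G = 2 * exp (- (T\<^sup>2 * t\<^sup>2 / 4))"
  have G: "norm (char U t) ^ k \<le> G" if "n \<le> k + 2" for k
    using norm_char_power_le_gauss[OF U m \<sigma> n that b t] by (simp add: G_def T2)
  have G0: "0 \<le> G" by (simp add: G_def)
  have "(CLINT s|?M. of_real (1 + (s / T)\<^sup>2) * iexp (t * s))
      = (CLINT s|?M. iexp (t * s) + of_real (1 / T\<^sup>2) * (of_real (s ^ 2) * iexp (t * s)))"
    by (intro Bochner_Integration.integral_cong) (simp_all add: algebra_simps power_divide)
  also have "\<dots> = char ?M t + of_real (1 / T\<^sup>2) * char_moment ?M 2 t"
    using integrable_char_moment[OF M, of 0 t] integrable_char_moment[OF M, of 2 t]
    by (simp add: char_def char_moment_def)
  also have "norm \<dots> \<le> norm (char ?M t) + 1 / T\<^sup>2 * norm (char_moment ?M 2 t)"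
    by (rule norm_triangle_ineq[THEN order_trans]) (simp add: norm_mult norm_divide norm_power)
  also have "\<dots> \<le> G + 1 / T\<^sup>2 * (n * G * \<sigma>\<^sup>2 + real n ^ 2 * G * (t * \<sigma>\<^sup>2)\<^sup>2)"
  proof (intro add_mono mult_left_mono)
    show "norm (char ?M t) \<le> G"
      using G[of n] by (simp add: char_moment_conv_power(1)[OF U] norm_power)
  next
    show "norm (char_moment ?M 2 t) \<le> n * G * \<sigma>\<^sup>2 + real n ^ 2 * G * (t * \<sigma>\<^sup>2)\<^sup>2"
    proof -
      have m1: "(norm (char_moment U 1 t))\<^sup>2 \<le> (t * \<sigma>\<^sup>2)\<^sup>2"
        using norm_char_moment_le(1)[OF U m, of t] t \<sigma> by (intro power_mono) auto
      have m2: "norm (char_moment U 2 t) \<le> \<sigma>\<^sup>2"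
        using norm_char_moment_le(2)[OF U m, of t] \<sigma> by simp
      have nn: "real (n * (n - 1)) \<le> real n ^ 2"
        unfolding power2_eq_square of_nat_mult by (intro mult_left_mono) auto
      have "norm (char_moment ?M 2 t) \<le> n * norm (char U t) ^ (n - 1) * norm (char_moment U 2 t)
          + real (n * (n - 1)) * norm (char U t) ^ (n - 2) * (norm (char_moment U 1 t))\<^sup>2"
        unfolding char_moment_conv_power(3)[OF U]
        by (rule norm_triangle_ineq[THEN order_trans]) (simp add: norm_mult norm_power del: of_nat_mult)
      also have "\<dots> \<le> n * G * \<sigma>\<^sup>2 + real n ^ 2 * G * (t * \<sigma>\<^sup>2)\<^sup>2"
        by (intro add_mono mult_mono m1 m2 nn G order_refl mult_nonneg_nonneg zero_le_power G0 norm_ge_zero)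
           (use n in auto)
      finally show ?thesis .
    qed
  qed simp
  also have "G + 1 / T\<^sup>2 * (n * G * \<sigma>\<^sup>2 + real n ^ 2 * G * (t * \<sigma>\<^sup>2)\<^sup>2) = G * (2 + T\<^sup>2 * t\<^sup>2)"
    unfolding T2 using \<sigma>(1) n by (simp add: field_simps power2_eq_square)
  \<comment> \<open>The polynomial factor is paid for by half of the Gaussian exponent.\<close>
  also have "\<dots> \<le> G * (8 * exp (T\<^sup>2 * t\<^sup>2 / 8))"
    using exp_ge_add_one_self[of "T\<^sup>2 * t\<^sup>2 / 8"] by (intro mult_left_mono G0) linarith
  also have "\<dots> = 16 * exp (- (T\<^sup>2 * t\<^sup>2 / 8))"
    by (simp add: G_def flip: exp_add)
  finally show ?thesis .
qed

text \<open>
  A quadratic weight is the natural choice: it is the highest power for which the moment assumption on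
  \<open>U\<close> suffices, and its reciprocal is already summable over cells of length \<open>T\<close>.
\<close>

lemma measure_conv_power_interval_le:
  assumes U: "real_distribution U" "integrable U (\<lambda>x. x\<^sup>2)" and m: "(LINT x|U. x) = 0"
    and \<sigma>: "\<sigma> > 0" "\<sigma>\<^sup>2 = (LINT x|U. x\<^sup>2)" and n: "n \<ge> 1"
    and b: "trunc_moment U \<sigma> n \<le> b * \<sigma>\<^sup>2" "3 / 8 * \<sigma> \<le> b"
    and T: "T = \<sigma> * sqrt n" "b \<le> T"
  shows "measure (conv_power U n) {u..u + b} \<le> 4608 * (b / T) * (1 / (1 + (u / T)\<^sup>2))"
proof -
  let ?M = "conv_power U n"
  have M: "real_distribution ?M" "integrable ?M (\<lambda>x. x\<^sup>2)"
    using U by (auto intro: real_distribution_conv_power integrable_square_conv_power)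
  interpret M: real_distribution ?M by fact
  have b0: "b > 0" and T0: "T > 0" using b \<sigma> T by auto
  define w where "w s = 1 + (s / T)\<^sup>2" for s
  \<comment> \<open>The bandwidth at which the Gaussian decay of the characteristic function stops.\<close>
  define a where "a = 1 / (4 * b)"
  have a: "a > 0" "a * b \<le> 1" using b0 by (auto simp: a_def)
  have wi: "integrable ?M w" unfolding w_def using M(2) by (simp add: power_divide)
  have "(LINT s|?M. w s * indicator {u..u + b} s) * (a / 4)
      \<le> (LINT t|lborel. 16 * exp (- (T\<^sup>2 * t\<^sup>2 / 8)))"
  proof (rule smoothing_inequality[OF M(1) wi _ a])
    fix t assume t: "0 < t" "t \<le> a"
    then have "t * b \<le> 1 / 4" using b0 mult_right_mono[of t a b] by (simp add: a_def)
    then show "norm (CLINT s|?M. of_real (w s) * iexp (t * s)) \<le> 16 * exp (- (T\<^sup>2 * t\<^sup>2 / 8))"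
      unfolding w_def by (intro weighted_char_conv_power_le[OF U m \<sigma> n b t(1) _ T(1)])
  qed (use gauss_integral[OF T0] in \<open>auto simp: w_def\<close>)
  also have "\<dots> \<le> 96 / T" using gauss_integral[OF T0] by simp
  finally have 1: "(LINT s|?M. w s * indicator {u..u + b} s) \<le> 1536 * (b / T)"
    using b0 T0 by (simp add: a_def field_simps)
  \<comment> \<open>As b <= T, the weight varies by a factor of at most 3 along the interval, so it can be
    replaced by its value at the left endpoint.\<close>
  have "w u * measure ?M {u..u + b} = (LINT s|?M. w u * indicator {u..u + b} s)"
    by simp
  also have "\<dots> \<le> (LINT s|?M. 3 * (w s * indicator {u..u + b} s))"
  proof (rule integral_mono)
    show "integrable ?M (\<lambda>s. 3 * (w s * indicator {u..u + b} s))"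
      by (intro integrable_mult_right integrable_real_mult_indicator wi) auto
    show "integrable ?M (\<lambda>s. w u * indicator {u..u + b} s)"
      by (intro integrable_mult_right integrable_real_indicator) (auto simp: M.emeasure_eq_measure)
    fix s
    show "w u * indicator {u..u + b} s \<le> 3 * (w s * indicator {u..u + b} s)"
    proof (cases "s \<in> {u..u + b}")
      case True
      define y z where "y = s / T" and "z = (s - u) / T"
      have "0 \<le> z" "z \<le> 1" using True T T0 by (auto simp: z_def)
      then have "z\<^sup>2 \<le> 1" by (intro power_le_one)
      moreover have "(y - z)\<^sup>2 \<le> 2 * y\<^sup>2 + 2 * z\<^sup>2"
        using sum_squares_bound[of y "- z"] by (simp add: power2_diff)
      moreover have "w u = 1 + (y - z)\<^sup>2" "w s = 1 + y\<^sup>2"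
        by (simp_all add: w_def y_def z_def diff_divide_distrib)
      ultimately have "w u \<le> 3 * w s"
        using zero_le_power2[of y] by linarith
      then show ?thesis using True by simp
    qed simp
  qed
  also have "\<dots> \<le> 3 * (1536 * (b / T))" using 1 by simp
  finally have "w u * measure ?M {u..u + b} \<le> 4608 * (b / T)" by simp
  moreover have "w u > 0" by (simp add: w_def add_pos_nonneg)
  ultimately have "measure ?M {u..u + b} \<le> 4608 * (b / T) / w u"
    by (simp only: pos_le_divide_eq mult.commute)
  then show ?thesis by (simp add: w_def)
qed

text \<open>
  For \<open>b \<le> T\<close>, with \<open>T = \<sigma> \<surd>n\<close>, the local bound is integrated against \<open>G\<close>. For \<open>b > T\<close> the
  claim says no more than that the concentration function grows at most linearly in the length of the interval.
\<close>

lemma conc_fun_convolution_conv_power_le: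
  assumes U: "real_distribution U" "integrable U (\<lambda>x. x\<^sup>2)" and m: "(LINT x|U. x) = 0"
    and \<sigma>: "\<sigma> > 0" "\<sigma>\<^sup>2 = (LINT x|U. x\<^sup>2)" and n: "n \<ge> 1"
    and b: "trunc_moment U \<sigma> n \<le> b * \<sigma>\<^sup>2" and G: "real_distribution G"
  shows "conc_fun (convolution G (conv_power U n)) b
    \<le> 4608 * cauchy_cell_sum * (b / (\<sigma> * sqrt n)) * conc_fun G (\<sigma> * sqrt n)"
proof -
  define T where "T = \<sigma> * sqrt n"
  have T0: "T > 0" using \<sigma> n by (simp add: T_def)
  have b\<sigma>: "3 / 8 * \<sigma> \<le> b"
    by (rule std_dev_le_of_trunc_moment_le[OF U \<sigma> n b])
  then have b0: "b > 0" using \<sigma> by linarith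
  have M: "real_distribution (conv_power U n)" by (rule real_distribution_conv_power) fact
  interpret M: real_distribution "conv_power U n" by fact
  interpret G: real_distribution G by fact
  interpret C: real_distribution "convolution G (conv_power U n)" by (intro real_distribution_convolution M G)
  have Q0: "0 \<le> conc_fun G T" by (rule conc_fun_nonneg) fact
  show ?thesis
  proof (cases "b \<le> T")
    case True
    show ?thesis
    proof (rule conc_fun_leI)
      fix x
      have "emeasure (convolution G (conv_power U n)) {x..x + b}
          = (\<integral>\<^sup>+ y. emeasure (conv_power U n) {x - y..x - y + b} \<partial>G)"
        by (rule emeasure_convolution_interval[OF G M])
      also have "\<dots> \<le> (\<integral>\<^sup>+ y. ennreal (4608 * (b / T)) * ennreal (1 / (1 + ((x - y) / T)\<^sup>2)) \<partial>G)"
        unfolding M.emeasure_eq_measure using b0 T0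
        by (intro nn_integral_mono)
           (simp add: ennreal_leI measure_conv_power_interval_le[OF U m \<sigma> n b b\<sigma> T_def True, simplified]
             flip: ennreal_mult'')
      also have "\<dots> = ennreal (4608 * (b / T)) * (\<integral>\<^sup>+ y. ennreal (1 / (1 + ((x - y) / T)\<^sup>2)) \<partial>G)"
        by (intro nn_integral_cmult) measurable
      also have "\<dots> \<le> ennreal (4608 * (b / T)) * ennreal (cauchy_cell_sum * conc_fun G T)"
        by (intro mult_left_mono nn_integral_cauchy_weight_le G T0) auto
      also have "\<dots> = ennreal (4608 * (b / T) * (cauchy_cell_sum * conc_fun G T))"
        using b0 T0 by (subst ennreal_mult'[symmetric]) auto
      finally have "measure (convolution G (conv_power U n)) {x..x + b}
          \<le> 4608 * (b / T) * (cauchy_cell_sum * conc_fun G T)"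
        using b0 T0 Q0 cauchy_cell_sum_ge by (simp add: C.emeasure_eq_measure ennreal_le_iff)
      then show "measure (convolution G (conv_power U n)) {x..x + b}
          \<le> 4608 * cauchy_cell_sum * (b / (\<sigma> * sqrt n)) * conc_fun G (\<sigma> * sqrt n)"
        by (simp add: T_def mult_ac)
    qed
  next
    case False
    \<comment> \<open>An interval longer than T is covered by at most 2b/T intervals of length T,
      and convolving with the power of U does not increase the concentration.\<close>
    then have "1 \<le> b / T" using T0 by simp
    have "conc_fun (convolution G (conv_power U n)) b \<le> conc_fun G b"
      by (rule conc_fun_convolution_le[OF G M])
    also have "\<dots> \<le> (b / T + 1) * conc_fun G T"
      using T0 b0 by (intro conc_fun_scale G) auto
    also have "\<dots> \<le> (4608 * cauchy_cell_sum * (b / T)) * conc_fun G T"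
    proof (rule mult_right_mono[OF _ Q0])
      have "2 * (b / T) \<le> 4608 * cauchy_cell_sum * (b / T)"
        using cauchy_cell_sum_ge b0 T0 by (intro mult_right_mono) auto
      then show "b / T + 1 \<le> 4608 * cauchy_cell_sum * (b / T)" using \<open>1 \<le> b / T\<close> by linarith
    qed
    finally show ?thesis by (simp add: T_def)
  qed
qed

text \<open>
  The truncated moment and the concentration function are monotone, so the bound for \<open>k\<close> summands holds with
  the scale \<open>\<sigma> \<surd>n\<close> in place of \<open>\<sigma> \<surd>k\<close>. The shift to \<open>k + 1\<close> covers \<open>k = 0\<close>, where \<open>b\<close> being at least of the order of \<open>\<sigma>\<close> is
  what saves the estimate.
\<close>

lemma conc_fun_le_any_power:
  assumes U: "real_distribution U" "integrable U (\<lambda>x. x\<^sup>2)" and m: "(LINT x|U. x) = 0"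
    and \<sigma>: "\<sigma> > 0" "\<sigma>\<^sup>2 = (LINT x|U. x\<^sup>2)" and n: "n \<ge> 1"
    and b: "trunc_moment U \<sigma> n \<le> b * \<sigma>\<^sup>2" and G: "real_distribution G" and k: "k \<le> n"
  shows "conc_fun (convolution G (conv_power U k)) b
    \<le> 9216 * cauchy_cell_sum * (b / \<sigma>) * (1 / sqrt (k + 1)) * conc_fun G (\<sigma> * sqrt n)"
proof -
  have Q0: "0 \<le> conc_fun G c" for c by (rule conc_fun_nonneg) fact
  have b\<sigma>: "3 / 8 * \<sigma> \<le> b"
    by (rule std_dev_le_of_trunc_moment_le[OF U \<sigma> n b])
  then have b0: "b > 0" using \<sigma> by linarith
  show ?thesis
  proof (cases "k = 0")
    case True
    define T where "T = \<sigma> * sqrt n"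
    have "\<sigma> * 1 \<le> T" unfolding T_def using n \<sigma> by (intro mult_left_mono) auto
    then have T: "T > 0" "\<sigma> \<le> T" using \<sigma> by auto
    have "conc_fun (convolution G (conv_power U k)) b \<le> conc_fun G b"
      by (intro conc_fun_convolution_le G real_distribution_conv_power U)
    also have "\<dots> \<le> (b / T + 1) * conc_fun G T"
      using T b0 by (intro conc_fun_scale G) auto
    also have "\<dots> \<le> (9216 * cauchy_cell_sum * (b / \<sigma>)) * conc_fun G T"
    proof (rule mult_right_mono[OF _ Q0])
      have "b / T \<le> b / \<sigma>" using T \<sigma> b0 by (intro divide_left_mono) auto
      moreover have "3 / 8 \<le> b / \<sigma>" using b\<sigma> \<sigma> by (simp add: field_simps)
      moreover have "4 * (b / \<sigma>) \<le> 9216 * cauchy_cell_sum * (b / \<sigma>)"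
        using cauchy_cell_sum_ge b0 \<sigma> by (intro mult_right_mono) auto
      ultimately show "b / T + 1 \<le> 9216 * cauchy_cell_sum * (b / \<sigma>)" by linarith
    qed
    finally show ?thesis using True by (simp add: T_def)
  next
    case False
    then have k1: "k \<ge> 1" by simp
    have "trunc_moment U \<sigma> k \<le> b * \<sigma>\<^sup>2"
      using trunc_moment_mono[OF U _ k, of \<sigma>] b \<sigma> by simp
    then have "conc_fun (convolution G (conv_power U k)) b
        \<le> 4608 * cauchy_cell_sum * (b / (\<sigma> * sqrt k)) * conc_fun G (\<sigma> * sqrt k)"
      by (rule conc_fun_convolution_conv_power_le[OF U m \<sigma> k1 _ G])
    also have "\<dots> \<le> 4608 * cauchy_cell_sum * (b / \<sigma> * (2 / sqrt (k + 1))) * conc_fun G (\<sigma> * sqrt n)"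
    proof (intro mult_mono conc_fun_mono G Q0)
      have "sqrt (k + 1) \<le> sqrt (4 * k)" using k1 by (intro real_sqrt_le_mono) auto
      then have "sqrt (k + 1) \<le> 2 * sqrt k" by (simp add: real_sqrt_mult)
      then have "1 / sqrt k \<le> 2 / sqrt (k + 1)" using k1 by (simp add: field_simps)
      then have "b / \<sigma> * (1 / sqrt k) \<le> b / \<sigma> * (2 / sqrt (k + 1))"
        using b0 \<sigma> by (intro mult_left_mono) auto
      then show "b / (\<sigma> * sqrt k) \<le> b / \<sigma> * (2 / sqrt (k + 1))" by simp
    qed (use k cauchy_cell_sum_ge b0 \<sigma> in auto)
    finally show ?thesis by simp
  qed
qed

section \<open>Mixtures and the binomial average\<close>

lemma conc_fun_convolution_mixture_le:
  assumes L: "real_distribution L" and F: "real_distribution F" and U: "real_distribution U"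
    and V: "real_distribution V" and p: "0 \<le> p" "p \<le> 1"
    and mix: "\<And>A. A \<in> sets borel \<Longrightarrow> measure F A = (1 - p) * measure U A + p * measure V A"
  shows "conc_fun (convolution L F) b
    \<le> (1 - p) * conc_fun (convolution L U) b + p * conc_fun (convolution L V) b"
proof (rule conc_fun_leI)
  interpret F: real_distribution F by fact
  interpret L: real_distribution L by fact
  interpret U: real_distribution U by fact
  interpret V: real_distribution V by fact
  interpret LF: real_distribution "convolution L F" by (intro real_distribution_convolution L F)
  interpret LU: real_distribution "convolution L U" by (intro real_distribution_convolution L U)
  interpret LV: real_distribution "convolution L V" by (intro real_distribution_convolution L V)
  fix x
  have meas [measurable]: "(\<lambda>y. emeasure N {x - y..x - y + b}) \<in> borel_measurable L"
    if N: "real_distribution N" for N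
  proof -
    interpret N: real_distribution N by fact
    have "(\<lambda>z. fst z + snd z) -` {x..x + b} \<inter> space (L \<Otimes>\<^sub>M N) \<in> sets (L \<Otimes>\<^sub>M N)"
      by (rule measurable_sets[of _ _ borel]) simp_all
    from N.measurable_emeasure_Pair[OF this]
    have "(\<lambda>y. emeasure N (Pair y -` ((\<lambda>z. fst z + snd z) -` {x..x + b} \<inter> space (L \<Otimes>\<^sub>M N))))
        \<in> borel_measurable L" .
    moreover have "Pair y -` ((\<lambda>z. fst z + snd z) -` {x..x + b} \<inter> space (L \<Otimes>\<^sub>M N)) = {x - y..x - y + b}" for y
      by (auto simp: space_pair_measure N.space_eq_univ L.space_eq_univ)
    ultimately show ?thesis by (simp only:)
  qed
  have "emeasure (convolution L F) {x..x + b} = (\<integral>\<^sup>+ y. emeasure F {x - y..x - y + b} \<partial>L)"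
    by (rule emeasure_convolution_interval[OF L F])
  also have "\<dots> = (\<integral>\<^sup>+ y. ennreal (1 - p) * emeasure U {x - y..x - y + b}
      + ennreal p * emeasure V {x - y..x - y + b} \<partial>L)"
  proof (rule nn_integral_cong)
    fix y
    have "emeasure F {x - y..x - y + b}
        = ennreal ((1 - p) * U.prob {x - y..x - y + b} + p * V.prob {x - y..x - y + b})"
      unfolding F.emeasure_eq_measure by (subst mix) simp_all
    also have "\<dots> = ennreal (1 - p) * emeasure U {x - y..x - y + b} + ennreal p * emeasure V {x - y..x - y + b}"
      unfolding U.emeasure_eq_measure V.emeasure_eq_measure
      using p by (subst ennreal_plus) (simp_all add: ennreal_mult')
    finally show "emeasure F {x - y..x - y + b}
        = ennreal (1 - p) * emeasure U {x - y..x - y + b} + ennreal p * emeasure V {x - y..x - y + b}" .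
  qed
  also have "\<dots> = ennreal (1 - p) * emeasure (convolution L U) {x..x + b}
      + ennreal p * emeasure (convolution L V) {x..x + b}"
    unfolding emeasure_convolution_interval[OF L U] emeasure_convolution_interval[OF L V]
    by (subst nn_integral_add) (auto simp: nn_integral_cmult meas U V intro!: borel_measurable_times_ennreal)
  also have "\<dots> = ennreal ((1 - p) * LU.prob {x..x + b} + p * LV.prob {x..x + b})"
    unfolding LU.emeasure_eq_measure LV.emeasure_eq_measure
    using p by (subst ennreal_plus) (simp_all add: ennreal_mult')
  finally have "LF.prob {x..x + b} = (1 - p) * LU.prob {x..x + b} + p * LV.prob {x..x + b}"
    unfolding LF.emeasure_eq_measure using p by (subst (asm) ennreal_inj) simp_all
  also have "\<dots> \<le> (1 - p) * conc_fun (convolution L U) b + p * conc_fun (convolution L V) b"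
    using p by (intro add_mono mult_left_mono measure_le_conc_fun real_distribution_convolution L U V) auto
  finally show "measure (convolution L F) {x..x + b}
    \<le> (1 - p) * conc_fun (convolution L U) b + p * conc_fun (convolution L V) b" .
qed

text \<open>
  The mean of \<open>1 / (N + j + 1)\<close> for \<open>N\<close> binomial with parameters \<open>m\<close> and \<open>1 - p\<close>: it is the integral of \<open>s ^ j\<close> against
  the generating function of \<open>N\<close>. In this form the recursion in \<open>m\<close> and the value at \<open>j = 0\<close> need no binomial
  coefficients.
\<close>

definition mix_weight :: "real \<Rightarrow> nat \<Rightarrow> nat \<Rightarrow> real" where
  "mix_weight p m j = (LINT s|lborel. s ^ j * (p + (1 - p) * s) ^ m * indicator {0..1} s)"

lemma integrable_mix_weight:
  fixes p :: real
  shows "integrable lborel (\<lambda>s. s ^ j * (p + (1 - p) * s) ^ m * indicator {0..1} s)"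
proof -
  have "integrable lborel (\<lambda>s. indicator {0..1} s *\<^sub>R (s ^ j * (p + (1 - p) * s) ^ m))"
    by (intro borel_integrable_compact) (auto intro!: continuous_intros)
  then show ?thesis by (simp add: mult_ac)
qed

lemma mix_weight_0: "mix_weight p 0 j = 1 / (real j + 1)"
proof -
  have "mix_weight p 0 j = 1 ^ Suc j / Suc j - 0 ^ Suc j / Suc j"
    by (simp add: mix_weight_def integral_power)
  then show ?thesis by (simp add: add.commute)
qed

lemma mix_weight_Suc: "mix_weight p (Suc m) j = (1 - p) * mix_weight p m (Suc j) + p * mix_weight p m j"
proof -
  have "mix_weight p (Suc m) j = (LINT s|lborel.
      (1 - p) * (s ^ Suc j * (p + (1 - p) * s) ^ m * indicator {0..1} s)
      + p * (s ^ j * (p + (1 - p) * s) ^ m * indicator {0..1} s))"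
    unfolding mix_weight_def by (intro Bochner_Integration.integral_cong) (simp_all add: algebra_simps)
  also have "\<dots> = (1 - p) * mix_weight p m (Suc j) + p * mix_weight p m j"
    unfolding mix_weight_def
    by (simp add: integrable_mix_weight integrable_mix_weight[of "Suc j", simplified] del: power_Suc)
  finally show ?thesis .
qed

lemma mix_weight_le:
  assumes "0 < p" "p < 1"
  shows "mix_weight p n 0 \<le> 1 / (real (n + 1) * (1 - p))"
proof -
  define P where "P s = (p + (1 - p) * s) ^ Suc n / (real (n + 1) * (1 - p))" for s
  have "mix_weight p n 0 = (LINT s|lborel. (p + (1 - p) * s) ^ n * indicator {0..1} s)"
    by (simp add: mix_weight_def)
  also have "\<dots> = P 1 - P 0"
  proof (rule integral_FTC_Icc_real)
    show "DERIV P s :> (p + (1 - p) * s) ^ n" for s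
    proof -
      have "(P has_field_derivative (real (Suc n) * (1 - p) * (p + (1 - p) * s) ^ n) / (real (n + 1) * (1 - p))) (at s)"
        unfolding P_def by (rule DERIV_cdivide) (auto intro!: derivative_eq_intros simp del: power_Suc)
      then show ?thesis using assms by simp
    qed
  qed (auto intro!: continuous_intros)
  also have "\<dots> \<le> P 1" using assms by (simp add: P_def)
  also have "P 1 = 1 / (real (n + 1) * (1 - p))" by (simp add: P_def)
  finally show ?thesis .
qed

text \<open>
  The convolution power is unfolded one factor at a time, each factor becoming \<open>U\<close> with weight \<open>1 - p\<close> or
  \<open>V\<close> with weight \<open>p\<close>. The induction runs over all \<open>G\<close> and counts in \<open>j\<close> the copies of \<open>U\<close> collected so far. The assumed
  bound has the form \<open>\<alpha> / (k + 1) + \<beta>\<close> because the average over \<open>k\<close> is linear in it.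
\<close>

lemma conc_fun_mixture_power_le:
  assumes F: "real_distribution F" and U: "real_distribution U"
    and V: "real_distribution V" and p: "0 \<le> p" "p \<le> 1"
    and mix: "\<And>A. A \<in> sets borel \<Longrightarrow> measure F A = (1 - p) * measure U A + p * measure V A"
    and bound: "\<And>k G. k \<le> N \<Longrightarrow> real_distribution G \<Longrightarrow>
      conc_fun (convolution G (conv_power U k)) b \<le> (\<alpha> * (1 / (real k + 1)) + \<beta>) * conc_fun G T"
    and nonneg: "0 \<le> \<alpha>" "0 \<le> \<beta>"
    and G: "real_distribution G" and N: "j + m \<le> N"
  shows "conc_fun (convolution (convolution G (conv_power U j)) (conv_power F m)) b
    \<le> (\<alpha> * mix_weight p m j + \<beta>) * conc_fun G T"
  using G N
proof (induction m arbitrary: j G)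
  case 0
  note D = real_distribution_conv_power[OF U] real_distribution_convolution
  have "conc_fun (convolution (convolution G (conv_power U j)) (conv_power F 0)) b
      \<le> conc_fun (convolution G (conv_power U j)) b"
    using 0 by (intro conc_fun_convolution_le D real_distribution_conv_power F) auto
  also have "\<dots> \<le> (\<alpha> * (1 / (real j + 1)) + \<beta>) * conc_fun G T"
    using 0 by (intro bound) auto
  finally show ?case by (simp add: mix_weight_0)
next
  case (Suc m)
  note G = \<open>real_distribution G\<close>
  note D = real_distribution_conv_power real_distribution_convolution F U V G
  have W0: "0 \<le> mix_weight p m i" for i
    unfolding mix_weight_def using p by (intro integral_nonneg_AE AE_I2) (auto split: split_indicator)
  define L where "L = convolution (convolution G (conv_power U j)) (conv_power F m)"
  have L: "real_distribution L" unfolding L_def by (intro D)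
  have LF: "convolution (convolution G (conv_power U j)) (conv_power F (Suc m)) = convolution L F"
    unfolding L_def conv_power.simps
    by (subst convolution_commute[OF F]) (simp_all add: convolution_assoc D)
  \<comment> \<open>Exposing one factor F and replacing it by U advances j; replacing it by V changes G into
    G V, whose concentration is no larger.\<close>
  have LU: "convolution L U = convolution (convolution G (conv_power U (Suc j))) (conv_power F m)"
  proof -
    have "convolution L U = convolution (convolution G (conv_power U j)) (convolution (conv_power F m) U)"
      unfolding L_def by (intro convolution_assoc D)
    also have "convolution (conv_power F m) U = convolution U (conv_power F m)"
      by (intro convolution_commute D)
    also have "convolution (convolution G (conv_power U j)) (convolution U (conv_power F m))
        = convolution (convolution (convolution G (conv_power U j)) U) (conv_power F m)"
      by (intro convolution_assoc[symmetric] D)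
    also have "convolution (convolution G (conv_power U j)) U = convolution G (convolution (conv_power U j) U)"
      by (intro convolution_assoc D)
    also have "convolution (conv_power U j) U = conv_power U (Suc j)"
      unfolding conv_power.simps by (intro convolution_commute D)
    finally show ?thesis .
  qed
  have LV: "convolution L V = convolution (convolution (convolution G V) (conv_power U j)) (conv_power F m)"
  proof -
    have "convolution L V = convolution V (convolution (convolution G (conv_power U j)) (conv_power F m))"
      unfolding L_def by (intro convolution_commute D)
    also have "\<dots> = convolution (convolution V (convolution G (conv_power U j))) (conv_power F m)"
      by (intro convolution_assoc[symmetric] D)
    also have "convolution V (convolution G (conv_power U j)) = convolution (convolution V G) (conv_power U j)"
      by (intro convolution_assoc[symmetric] D)
    also have "convolution V G = convolution G V" by (intro convolution_commute D)
    finally show ?thesis .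
  qed
  have 1: "conc_fun (convolution L U) b \<le> (\<alpha> * mix_weight p m (Suc j) + \<beta>) * conc_fun G T"
    unfolding LU using Suc.prems by (intro Suc.IH) auto
  have "conc_fun (convolution L V) b \<le> (\<alpha> * mix_weight p m j + \<beta>) * conc_fun (convolution G V) T"
    unfolding LV using Suc.prems by (intro Suc.IH D) auto
  also have "\<dots> \<le> (\<alpha> * mix_weight p m j + \<beta>) * conc_fun G T"
    using nonneg W0 by (intro mult_left_mono conc_fun_convolution_le D) auto
  finally have 2: "conc_fun (convolution L V) b \<le> (\<alpha> * mix_weight p m j + \<beta>) * conc_fun G T" .
  have "conc_fun (convolution L F) b
      \<le> (1 - p) * conc_fun (convolution L U) b + p * conc_fun (convolution L V) b"
    by (rule conc_fun_convolution_mixture_le[OF L F U V p mix])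
  also have "\<dots> \<le> (1 - p) * ((\<alpha> * mix_weight p m (Suc j) + \<beta>) * conc_fun G T)
      + p * ((\<alpha> * mix_weight p m j + \<beta>) * conc_fun G T)"
    using p 1 2 by (intro add_mono mult_left_mono) auto
  also have "\<dots> = (\<alpha> * mix_weight p (Suc m) j + \<beta>) * conc_fun G T"
    by (simp add: mix_weight_Suc algebra_simps)
  finally show ?case unfolding LF .
qed

theorem corollary1:
  shows "\<exists>c::real. c > 0 \<and>
    (\<forall>(n::nat) (p::real) (\<sigma>::real) (b::real)
       (F::real measure) (U::real measure) (V::real measure) (H::real measure).
       n \<ge> 1 \<longrightarrow>
       real_distribution F \<longrightarrow> real_distribution U \<longrightarrow>
       real_distribution V \<longrightarrow> real_distribution H \<longrightarrow>
       0 < p \<longrightarrow> p < 1 \<longrightarrow>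
       (\<forall>A \<in> sets borel. measure F A = (1 - p) * measure U A + p * measure V A) \<longrightarrow>
       integrable U (\<lambda>x. x\<^sup>2) \<longrightarrow>
       \<sigma> > 0 \<longrightarrow> \<sigma>\<^sup>2 = (LINT x|U. x\<^sup>2) \<longrightarrow>
       (LINT x|U. x) = 0 \<longrightarrow>
       b \<ge> trunc_moment U \<sigma> n / \<sigma>\<^sup>2 \<longrightarrow>
       conc_fun (convolution H (conv_power F n)) b
         \<le> c * b / (\<sigma> * sqrt (real n * (1 - p))) * conc_fun H (\<sigma> * sqrt (real n)))"
proof (intro exI[of _ "9216 * cauchy_cell_sum"] conjI allI impI)
  show "0 < 9216 * cauchy_cell_sum" using cauchy_cell_sum_ge by simp
next
  fix n :: nat and p \<sigma> b :: real and F U V H :: "real measure"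
  assume n: "n \<ge> 1" and F: "real_distribution F" and U: "real_distribution U"
    and V: "real_distribution V" and H: "real_distribution H" and p: "0 < p" "p < 1"
    and mix: "\<forall>A \<in> sets borel. measure F A = (1 - p) * measure U A + p * measure V A"
    and U2: "integrable U (\<lambda>x. x\<^sup>2)" and \<sigma>: "\<sigma> > 0" "\<sigma>\<^sup>2 = (LINT x|U. x\<^sup>2)"
    and m: "(LINT x|U. x) = 0" and b: "b \<ge> trunc_moment U \<sigma> n / \<sigma>\<^sup>2"
  have b': "trunc_moment U \<sigma> n \<le> b * \<sigma>\<^sup>2" using b \<sigma>(1) by (simp add: field_simps)
  have "3 / 8 * \<sigma> \<le> b"
    by (rule std_dev_le_of_trunc_moment_le[OF U U2 \<sigma> n b'])
  then have b0: "b > 0" using \<sigma> by linarith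
  define T where "T = \<sigma> * sqrt n"
  define K where "K = 9216 * cauchy_cell_sum * (b / \<sigma>)"
  define l where "l = sqrt (real n * (1 - p))"
  have K0: "K \<ge> 0" using cauchy_cell_sum_ge b0 \<sigma> by (simp add: K_def)
  have l0: "l > 0" and l2: "l\<^sup>2 = real n * (1 - p)" using n p by (auto simp: l_def)
  have Q0: "0 \<le> conc_fun G T" if "real_distribution G" for G by (rule conc_fun_nonneg) fact
  define \<alpha> \<beta> where "\<alpha> = K * l / 2" and "\<beta> = K / (2 * l)"
  \<comment> \<open>The mean of 1/sqrt(k+1) is not explicit but that of 1/(k+1) is; the arithmetic-geometric
    mean inequality with this l passes from one to the other at no loss of order.\<close>
  have bound: "conc_fun (convolution G (conv_power U k)) b \<le> (\<alpha> * (1 / (real k + 1)) + \<beta>) * conc_fun G T"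
    if k: "k \<le> n" and G: "real_distribution G" for k G
  proof -
    define r where "r = 1 / sqrt (real k + 1)"
    have r2: "r\<^sup>2 = 1 / (real k + 1)" by (simp add: r_def power_divide)
    have "conc_fun (convolution G (conv_power U k)) b \<le> K * r * conc_fun G T"
      using conc_fun_le_any_power[OF U U2 m \<sigma> n b' G k] by (simp add: K_def r_def T_def add.commute)
    also have "\<dots> \<le> K * (l * r\<^sup>2 / 2 + 1 / (2 * l)) * conc_fun G T"
    proof (intro mult_right_mono mult_left_mono K0 Q0 G)
      have "0 \<le> (l * r - 1)\<^sup>2 / (2 * l)" using l0 by simp
      also have "\<dots> = l * r\<^sup>2 / 2 + 1 / (2 * l) - r"
        using l0 by (simp add: field_simps power2_eq_square)
      finally show "r \<le> l * r\<^sup>2 / 2 + 1 / (2 * l)" by simp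
    qed
    also have "K * (l * r\<^sup>2 / 2 + 1 / (2 * l)) = \<alpha> * (1 / (real k + 1)) + \<beta>"
      by (simp add: \<alpha>_def \<beta>_def r2 algebra_simps)
    finally show ?thesis .
  qed
  have H0: "convolution H (conv_power U 0) = H"
    using convolution_return_0[OF H] by simp
  have "conc_fun (convolution (convolution H (conv_power U 0)) (conv_power F n)) b
      \<le> (\<alpha> * mix_weight p n 0 + \<beta>) * conc_fun H T"
    by (rule conc_fun_mixture_power_le[where N = n, OF F U V _ _ _ bound])
       (use mix p K0 l0 H in \<open>auto simp: \<alpha>_def \<beta>_def\<close>)
  also have "\<dots> \<le> (\<alpha> * (1 / l\<^sup>2) + \<beta>) * conc_fun H T"
  proof (intro mult_right_mono add_mono mult_left_mono Q0 H order_refl)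
    have "mix_weight p n 0 \<le> 1 / (real (n + 1) * (1 - p))" by (rule mix_weight_le) fact+
    also have "\<dots> \<le> 1 / l\<^sup>2"
      unfolding l2 using n p by (intro divide_left_mono mult_right_mono mult_pos_pos) auto
    finally show "mix_weight p n 0 \<le> 1 / l\<^sup>2" .
  qed (use K0 l0 in \<open>auto simp: \<alpha>_def\<close>)
  also have "\<alpha> * (1 / l\<^sup>2) + \<beta> = K / l"
    using l0 by (simp add: \<alpha>_def \<beta>_def field_simps power2_eq_square)
  finally show "conc_fun (convolution H (conv_power F n)) b
      \<le> 9216 * cauchy_cell_sum * b / (\<sigma> * sqrt (real n * (1 - p))) * conc_fun H (\<sigma> * sqrt (real n))"
    unfolding H0 by (simp add: K_def l_def T_def)
qed

end
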